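(* Let $g\in(0,\infty)$ be a nonrandom constant. Let $(Z_t)_{t\ge 0}$ be a continuous $\mathcal F$-adapted local martingale with nonrandom quadratic variation $\langle Z\rangle$, such that $Z_0=0$ and $\langle Z\rangle_\infty=\infty$. Let $W$ be a standard Wiener process. Then $$P_g^Z(t)=P_g^W\big(\langle Z\rangle_t\big)\qquad\text{for all } t\ge 0.$$
   Context: Work on a complete stochastic basis $(\Omega,\mathbb P,\Sigma,\mathcal F)$, where $\mathcal F=(\mathcal F_t)_{t\ge0}$ is a filtration. For an $\mathcal F$-adapted continuous process $X$ with $X_0=0$ and a constant $g>0$, the first-passage time is $\mathrm T_g^X=\inf\{t\ge 0: X_t\ge g\}$, and the boundary crossing probability is $P_g^X(t)=\mathbb P(\mathrm T_g^X\le t)=\mathbb P(\sup_{0\le s\le t}X_s\ge g)$ for $t\ge0$. "Nonrandom quadratic variation" means that $t\mapsto\langle Z\rangle_t$ is a (time-varying) deterministic function, and $\langle Z\rangle_\infty=\lim_{t\to\infty}\langle Z\rangle_t$. The Wiener process $W$ is $\mathcal F$-adapted. *)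

theory Defs
  imports "HOL-Probability.Probability"
begin

text \<open>
  Time is the half-line of nonnegative reals. Filtrations and processes are functions on \<^typ>\<open>real\<close>,
  and only their values at nonnegative arguments are ever constrained or used. Path properties
  (continuity, monotonicity, initial value) are required almost surely.
\<close>

locale complete_stochastic_basis = prob_space M + complete_measure M
  for M :: "'a measure" +
  fixes F :: "real \<Rightarrow> 'a measure"
  assumes subalgebra_F: "0 \<le> t \<Longrightarrow> subalgebra M (F t)"
    and F_mono: "0 \<le> s \<Longrightarrow> s \<le> t \<Longrightarrow> sets (F s) \<subseteq> sets (F t)"
    and null_sets_F: "null_sets M \<subseteq> sets (F 0)"

definition adapted :: "(real \<Rightarrow> 'a measure) \<Rightarrow> (real \<Rightarrow> 'a \<Rightarrow> real) \<Rightarrow> bool" where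
  "adapted F X \<longleftrightarrow> (\<forall>t\<ge>0. X t \<in> borel_measurable (F t))"

definition continuous_process :: "'a measure \<Rightarrow> (real \<Rightarrow> 'a \<Rightarrow> real) \<Rightarrow> bool" where
  "continuous_process M X \<longleftrightarrow> (AE \<omega> in M. continuous_on {0..} (\<lambda>t. X t \<omega>))"

definition starts_at_zero :: "'a measure \<Rightarrow> (real \<Rightarrow> 'a \<Rightarrow> real) \<Rightarrow> bool" where
  "starts_at_zero M X \<longleftrightarrow> (AE \<omega> in M. X 0 \<omega> = 0)"

definition martingale :: "'a measure \<Rightarrow> (real \<Rightarrow> 'a measure) \<Rightarrow> (real \<Rightarrow> 'a \<Rightarrow> real) \<Rightarrow> bool" where
  "martingale M F X \<longleftrightarrow>
     adapted F X \<and>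
     (\<forall>t\<ge>0. integrable M (X t)) \<and>
     (\<forall>s t. 0 \<le> s \<and> s \<le> t \<longrightarrow> (AE \<omega> in M. real_cond_exp M (F s) (X t) \<omega> = X s \<omega>))"

text \<open>
  The library's \<^const>\<open>stopping_time\<close> takes values in the index type of the filtration and hence
  does not allow the value infinity for a filtration indexed by the reals.
\<close>

definition ext_stopping_time :: "(real \<Rightarrow> 'a measure) \<Rightarrow> ('a \<Rightarrow> ennreal) \<Rightarrow> bool" where
  "ext_stopping_time F T \<longleftrightarrow> (\<forall>t\<ge>0. Measurable.pred (F t) (\<lambda>\<omega>. T \<omega> \<le> ennreal t))"

definition stopped :: "(real \<Rightarrow> 'a \<Rightarrow> real) \<Rightarrow> ('a \<Rightarrow> ennreal) \<Rightarrow> real \<Rightarrow> 'a \<Rightarrow> real" where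
  "stopped X T t \<omega> = X (enn2real (min (ennreal t) (T \<omega>))) \<omega>"

definition local_martingale :: "'a measure \<Rightarrow> (real \<Rightarrow> 'a measure) \<Rightarrow> (real \<Rightarrow> 'a \<Rightarrow> real) \<Rightarrow> bool" where
  "local_martingale M F X \<longleftrightarrow>
     adapted F X \<and>
     (\<exists>T :: nat \<Rightarrow> 'a \<Rightarrow> ennreal.
        (\<forall>n. ext_stopping_time F (T n)) \<and>
        (AE \<omega> in M. incseq (\<lambda>n. T n \<omega>) \<and> (\<lambda>n. T n \<omega>) \<longlonglongrightarrow> \<infinity>) \<and>
        (\<forall>n. martingale M F (stopped X (T n))))"

text \<open>
  For a continuous local martingale \<open>Z\<close> with \<open>Z 0 = 0\<close>, the quadratic variation is the process,
  unique up to indistinguishability, that is adapted, continuous, nondecreasing, null at time 0 and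
  turns \<open>Z\<^sup>2\<close> into a local martingale when subtracted from it.
\<close>

definition quadratic_variation ::
  "'a measure \<Rightarrow> (real \<Rightarrow> 'a measure) \<Rightarrow> (real \<Rightarrow> 'a \<Rightarrow> real) \<Rightarrow> (real \<Rightarrow> 'a \<Rightarrow> real) \<Rightarrow> bool" where
  "quadratic_variation M F Z V \<longleftrightarrow>
     adapted F V \<and> continuous_process M V \<and> starts_at_zero M V \<and>
     (AE \<omega> in M. mono_on {0..} (\<lambda>t. V t \<omega>)) \<and>
     local_martingale M F (\<lambda>t \<omega>. (Z t \<omega>)\<^sup>2 - V t \<omega>)"

definition wiener_process :: "'a measure \<Rightarrow> (real \<Rightarrow> 'a \<Rightarrow> real) \<Rightarrow> bool" where
  "wiener_process M W \<longleftrightarrow>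
     (\<forall>t\<ge>0. W t \<in> borel_measurable M) \<and> continuous_process M W \<and> starts_at_zero M W \<and>
     (\<forall>s t. 0 \<le> s \<and> s < t \<longrightarrow>
        distributed M lborel (\<lambda>\<omega>. W t \<omega> - W s \<omega>) (normal_density 0 (sqrt (t - s)))) \<and>
     (\<forall>(n::nat) u :: nat \<Rightarrow> real. 0 \<le> u 0 \<and> (\<forall>i<n. u i \<le> u (Suc i)) \<longrightarrow>
        prob_space.indep_vars M (\<lambda>_. borel) (\<lambda>i \<omega>. W (u (Suc i)) \<omega> - W (u i) \<omega>) {..<n})"

text \<open>The infimum of the empty set is infinity.\<close>

definition first_passage_time :: "(real \<Rightarrow> 'a \<Rightarrow> real) \<Rightarrow> real \<Rightarrow> 'a \<Rightarrow> ennreal" where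
  "first_passage_time X g \<omega> = Inf {ennreal t | t. 0 \<le> t \<and> g \<le> X t \<omega>}"

definition crossing_prob :: "'a measure \<Rightarrow> (real \<Rightarrow> 'a \<Rightarrow> real) \<Rightarrow> real \<Rightarrow> real \<Rightarrow> real" where
  "crossing_prob M X g t = measure M {\<omega> \<in> space M. first_passage_time X g \<omega> \<le> ennreal t}"

end

theory Submission
  imports Defs
begin

text \<open>
  The increments of \<open>Z\<close> are independent of the past and normally distributed with variances given by the
  increments of \<open>q\<close>, so \<open>Z\<close> and the time-changed Wiener process \<open>u \<mapsto> W (q u)\<close> have the same
  finite-dimensional distributions; by continuity of paths their suprema over \<open>{0..t}\<close> have the same law,
  and the supremum of \<open>W (q u)\<close> over \<open>{0..t}\<close> is that of \<open>W\<close> over \<open>{0..q t}\<close>.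

  Fatou's lemma and Doob's inequality show first that \<open>Z\<close> and \<open>Z\<^sup>2 - q\<close> are true martingales with an integrable
  bound for the supremum of \<open>Z\<^sup>2\<close>. The conditional characteristic function of \<open>Z t - Z s\<close> is then found by
  a second-order Taylor expansion along refining grids, as in the central limit theorem: the integrable bound
  supplies the Lindeberg condition, and neither stochastic integrals nor a Dambis-Dubins-Schwarz time change is needed.
\<close>

section \<open>Grids and pathwise estimates\<close>

text \<open>What replaces independence in the limit argument is that the conditional variance of an
  increment is a number: against a weight known at time \<open>s\<close>, the square of
  \<open>Z t - Z s\<close> integrates to \<open>q t - q s\<close> times the integral of the weight.
  The recursion for the expected exponential therefore closes, and after multiplication by a
  Gaussian compensator it is nearly constant along the grid. Carrying an arbitrary past event
  through the computation makes the result conditional, so independence of the past comes together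
  with normality. The obstacle is integrability. \<open>Z\<close> and \<open>Z\<^sup>2 - V\<close>
  are localised by two unrelated sequences, and neither is assumed to make \<open>Z\<close> square
  integrable. The square of \<open>Z\<close> stopped by one sequence has to be estimated through the
  other. At grid times stopping is only a telescoping sum with gated terms, and the resulting bound
  \<open>q t\<close> does not depend on either sequence, so both can be removed in the
  limit.\<close>

definition grid :: "real \<Rightarrow> real \<Rightarrow> nat \<Rightarrow> nat \<Rightarrow> real" where
  "grid a b k i = a + (b - a) * (real i / real k)"

lemma grid_0 [simp]: "grid a b k 0 = a"
  by (simp add: grid_def)

lemma grid_end [simp]: "0 < k \<Longrightarrow> grid a b k k = b"
  by (simp add: grid_def)

lemma grid_mono: "a \<le> b \<Longrightarrow> i \<le> j \<Longrightarrow> grid a b k i \<le> grid a b k j"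
  unfolding grid_def by (intro add_left_mono mult_left_mono divide_right_mono) auto

text \<open>Holds for every index, also beyond \<open>k\<close>, where the grid runs on past
  \<open>b\<close>; only the upper bound \<open>grid_le\<close> needs
  \<open>i \<le> k\<close>.\<close>

lemma grid_ge: "a \<le> b \<Longrightarrow> a \<le> grid a b k i"
  using grid_mono[of a b 0 i k] by simp

lemma grid_le: "a \<le> b \<Longrightarrow> i \<le> k \<Longrightarrow> grid a b k i \<le> b"
  by (cases "k = 0") (use grid_mono[of a b i k k] in auto)

lemma grid_Suc_diff: "grid a b k (Suc i) - grid a b k i = (b - a) / real k"
  by (simp add: grid_def add_divide_distrib algebra_simps)

lemma grid_approx:
  assumes "a \<le> u" "u \<le> b" "0 < k"
  shows "\<exists>i\<le>k. \<bar>grid a b k i - u\<bar> \<le> (b - a) / real k"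
proof -
  \<comment> \<open>The least grid point at or above \<open>u\<close> works: its predecessor lies
    strictly below \<open>u\<close>, so \<open>u\<close> is within one step. Index 0 forces
    \<open>u = a\<close>.\<close>
  have "\<exists>j\<le>k. u \<le> grid a b k j"
    using assms by (intro exI[of _ k]) auto
  then have least: "u \<le> grid a b k (LEAST j. u \<le> grid a b k j)" (is "u \<le> grid a b k ?j")
    by (meson LeastI_ex)
  have jk: "?j \<le> k"
    using assms by (intro Least_le) auto
  show ?thesis
  proof (cases ?j)
    case 0
    then show ?thesis
      using least assms by (intro exI[of _ 0]) (auto simp: field_simps)
  next
    case (Suc i)
    then have "\<not> u \<le> grid a b k i"
      using not_less_Least[of i "\<lambda>j. u \<le> grid a b k j"] by simp
    then show ?thesis
      using least Suc jk grid_Suc_diff[of a b k i] by (intro exI[of _ ?j]) auto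
  qed
qed

lemma grid_width_tendsto_0: "(\<lambda>k. c / real k) \<longlonglongrightarrow> 0"
  by (rule lim_const_over_n)

text \<open>Uniform continuity on a compact interval. It has two uses: for paths of \<open>Z\<close>
  it makes the switch \<open>ok\<close> eventually 1, and for \<open>q\<close> it makes the variance
  of each single step small.\<close>

lemma continuous_on_grid_steps:
  fixes f :: "real \<Rightarrow> real"
  assumes "a \<le> b" "continuous_on {a..b} f" "0 < e"
  shows "eventually (\<lambda>k. \<forall>i<k. \<bar>f (grid a b k (Suc i)) - f (grid a b k i)\<bar> \<le> e) sequentially"
proof -
  have "uniformly_continuous_on {a..b} f"
    using assms by (intro compact_uniformly_continuous) auto
  then obtain d where d: "d > 0"
    "\<And>x y. x \<in> {a..b} \<Longrightarrow> y \<in> {a..b} \<Longrightarrow> dist x y < d \<Longrightarrow> dist (f x) (f y) < e"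
    unfolding uniformly_continuous_on_def using assms(3) by metis
  have "eventually (\<lambda>k. (b - a) / real k < d) sequentially"
    using grid_width_tendsto_0[of "b - a"] d(1) by (rule order_tendstoD)
  then show ?thesis
  proof eventually_elim
    case (elim k)
    show ?case
    proof (intro allI impI)
      fix i assume "i < k"
      then have "dist (f (grid a b k (Suc i))) (f (grid a b k i)) < e"
        using assms(1) elim by (intro d(2)) (auto simp: grid_ge grid_le dist_real_def grid_Suc_diff)
      then show "\<bar>f (grid a b k (Suc i)) - f (grid a b k i)\<bar> \<le> e"
        by (simp add: dist_real_def)
    qed
  qed
qed

lemma exists_grid_seq:
  assumes "a \<le> u" "u \<le> b"
  obtains r :: "nat \<Rightarrow> nat" where "\<And>k. r k \<le> k" "(\<lambda>k. grid a b k (r k)) \<longlonglongrightarrow> u"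
proof -
  have "\<forall>k. \<exists>i\<le>k. 0 < k \<longrightarrow> \<bar>grid a b k i - u\<bar> \<le> (b - a) / real k"
    using grid_approx[OF assms] by blast
  then obtain r where r: "\<And>k. r k \<le> k" "\<And>k. 0 < k \<Longrightarrow> \<bar>grid a b k (r k) - u\<bar> \<le> (b - a) / real k"
    by metis
  have "(\<lambda>k. grid a b k (r k) - u) \<longlonglongrightarrow> 0"
    by (rule Lim_null_comparison[OF _ grid_width_tendsto_0[of "b - a"]])
      (auto intro!: eventually_mono[OF eventually_gt_at_top[of 0]] r(2))
  then have "(\<lambda>k. grid a b k (r k)) \<longlonglongrightarrow> u"
    using Lim_null by blast
  with r(1) show thesis by (rule that)
qed

text \<open>Pathwise form of Doob's inequality: if \<open>x\<close> is the absolute value of a martingale, the sum on the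
  left has nonnegative expectation.\<close>

lemma pathwise_Doob:
  fixes x :: "nat \<Rightarrow> real"
  assumes "\<And>i. 0 \<le> x i"
  shows "(\<Sum>k<n. Max (x ` {..k}) * (x (Suc k) - x k)) + (Max (x ` {..n}))\<^sup>2 / 4 \<le> (x n)\<^sup>2"
proof -
  define m where "m k = Max (x ` {..k})" for k
  have m_Suc: "m (Suc k) = max (x (Suc k)) (m k)" for k
    by (simp add: m_def atMost_Suc)
  \<comment> \<open>The bound comes from summation by parts, since the running maximum changes only
    at indices where it equals \<open>x\<close>. The mixed term \<open>m n * x n\<close> is removed
    afterwards by the square of \<open>m n / 2 - x n\<close>.\<close>
  have "(\<Sum>k<n. m k * (x (Suc k) - x k)) \<le> m n * x n - (m n)\<^sup>2 / 2"
  proof (induction n)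
    case 0
    show ?case by (simp add: m_def power2_eq_square)
  next
    case (Suc n)
    show ?case
    proof (cases "x (Suc n) \<le> m n")
      case True
      with Suc show ?thesis by (simp add: m_Suc max_def algebra_simps)
    next
      case False
      then have "m (Suc n) = x (Suc n)" by (simp add: m_Suc)
      \<comment> \<open>At a new record the right-hand side gains
        \<open>(x (Suc n) - m n)\<^sup>2 / 2\<close> more than the left.\<close>
      moreover have "(x (Suc n) - m n)\<^sup>2 \<ge> 0" by simp
      ultimately show ?thesis
        using Suc by (simp add: power2_eq_square algebra_simps)
    qed
  qed
  moreover have "(m n / 2 - x n)\<^sup>2 \<ge> 0" by simp
  ultimately show ?thesis
    unfolding m_def[symmetric] by (simp add: power2_eq_square algebra_simps)
qed

text \<open>Once \<open>b\<close> has failed it never holds again, so the gated sum telescopes up to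
  the first failure, or to \<open>k\<close> if there is none. With \<open>b i\<close> read as "not
  yet stopped at step \<open>i\<close>", this is discrete optional stopping on a single
  path.\<close>

lemma stopped_sum:
  fixes y :: "nat \<Rightarrow> real"
  assumes anti: "\<And>i j. i \<le> j \<Longrightarrow> b j \<Longrightarrow> b i"
  shows "\<exists>j\<le>k. (\<Sum>i<k. (if b i then y (Suc i) - y i else 0)) = y j - y 0 \<and> (\<forall>i<j. b i) \<and> (j < k \<longrightarrow> \<not> b j)"
proof (induction k)
  case 0
  then show ?case by auto
next
  case (Suc k)
  then obtain j where j: "j \<le> k" "(\<Sum>i<k. (if b i then y (Suc i) - y i else 0)) = y j - y 0"
    "\<forall>i<j. b i" "j < k \<longrightarrow> \<not> b j" by blast
  show ?case
  proof (cases "b k")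
    case True
    then have "j = k" using j anti[of j k] by (cases "j = k") auto
    then show ?thesis using True j by (intro exI[of _ "Suc k"]) (auto simp: less_Suc_eq)
  next
    case False
    then show ?thesis using j by (intro exI[of _ j]) (auto simp: less_Suc_eq le_less)
  qed
qed

section \<open>Martingales\<close>

context complete_stochastic_basis
begin

lemma borel_measurable_F:
  assumes "0 \<le> s" "f \<in> borel_measurable (F s)"
  shows "f \<in> borel_measurable M"
  using measurable_from_subalg[OF subalgebra_F[OF assms(1)] assms(2)] .

lemma borel_measurable_F_mono:
  assumes "0 \<le> s" "s \<le> t" "f \<in> borel_measurable (F s)"
  shows "f \<in> borel_measurable (F t)"
proof -
  have "subalgebra (F t) (F s)"
    using subalgebra_F[of s] subalgebra_F[of t] F_mono[of s t] assms by (auto simp: subalgebra_def)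
  then show ?thesis using assms(3) by (rule measurable_from_subalg)
qed

lemma sigma_finite_subalgebra_F: "0 \<le> s \<Longrightarrow> sigma_finite_subalgebra M (F s)"
  by (intro finite_measure_subalgebra_is_sigma_finite finite_measure_subalgebra.intro
      finite_measure_subalgebra_axioms.intro subalgebra_F finite_measure_axioms)

text \<open>The weight \<open>f\<close> may be unbounded: integrability against the later value
  suffices, and conditional expectation passes it on to the earlier one. The weights in use include
  a running maximum and \<open>h * Z s\<close>.\<close>

lemma martingale_integral_mult:
  assumes X: "martingale M F X" and st: "0 \<le> s" "s \<le> t"
    and f: "f \<in> borel_measurable (F s)" "integrable M (\<lambda>\<omega>. f \<omega> * X t \<omega>)"
  shows "integrable M (\<lambda>\<omega>. f \<omega> * X s \<omega>)"
    and "(\<integral>\<omega>. f \<omega> * X s \<omega> \<partial>M) = (\<integral>\<omega>. f \<omega> * X t \<omega> \<partial>M)"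
proof -
  interpret s: sigma_finite_subalgebra M "F s"
    by (rule sigma_finite_subalgebra_F[OF st(1)])
  have [measurable]: "f \<in> borel_measurable M" "X s \<in> borel_measurable M" "X t \<in> borel_measurable M"
    using X st borel_measurable_F[OF st(1) f(1)]
    by (auto simp: martingale_def intro!: borel_measurable_integrable)
  have ae: "AE \<omega> in M. f \<omega> * real_cond_exp M (F s) (X t) \<omega> = f \<omega> * X s \<omega>"
  proof -
    have "AE \<omega> in M. real_cond_exp M (F s) (X t) \<omega> = X s \<omega>"
      using X st unfolding martingale_def by blast
    then show ?thesis by eventually_elim simp
  qed
  have "X t \<in> borel_measurable M" by measurable
  note ce = s.real_cond_exp_intg[OF f(2) f(1) this]
  show "integrable M (\<lambda>\<omega>. f \<omega> * X s \<omega>)"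
    using ce(1) by (rule Bochner_Integration.integrable_cong_AE_imp) (use ae in auto)
  have "(\<integral>\<omega>. f \<omega> * X s \<omega> \<partial>M) = (\<integral>\<omega>. f \<omega> * real_cond_exp M (F s) (X t) \<omega> \<partial>M)"
    using ae by (intro integral_cong_AE) auto
  also have "\<dots> = (\<integral>\<omega>. f \<omega> * X t \<omega> \<partial>M)"
    using ce(2) by simp
  finally show "(\<integral>\<omega>. f \<omega> * X s \<omega> \<partial>M) = (\<integral>\<omega>. f \<omega> * X t \<omega> \<partial>M)" .
qed

text \<open>A bet decided at time \<open>s\<close> has mean zero. These are the summands of the
  gated sums of \<open>stopped_sum\<close>.\<close>

lemma martingale_integral_indicator:
  assumes X: "martingale M F X" and st: "0 \<le> s" "s \<le> t" and P: "Measurable.pred (F s) P"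
  shows "(\<integral>\<omega>. (if P \<omega> then X t \<omega> - X s \<omega> else 0) \<partial>M) = 0"
    and "integrable M (\<lambda>\<omega>. if P \<omega> then X t \<omega> - X s \<omega> else 0)"
proof -
  define f where "f \<omega> = (if P \<omega> then 1 else 0 :: real)" for \<omega>
  have f: "f \<in> borel_measurable (F s)" using P unfolding f_def by measurable
  then have fM[measurable]: "f \<in> borel_measurable M" using st by (intro borel_measurable_F)
  have it: "integrable M (X t)" "integrable M (X s)"
    using X st by (auto simp: martingale_def)
  have int: "integrable M (\<lambda>\<omega>. f \<omega> * X t \<omega>)"
    by (rule Bochner_Integration.integrable_bound[OF it(1)])
      (use it in \<open>simp, auto simp: f_def\<close>)
  note mg = martingale_integral_mult[OF X st f int]
  have *: "(\<lambda>\<omega>. if P \<omega> then X t \<omega> - X s \<omega> else 0) = (\<lambda>\<omega>. f \<omega> * X t \<omega> - f \<omega> * X s \<omega>)"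
    by (auto simp: f_def)
  show "(\<integral>\<omega>. (if P \<omega> then X t \<omega> - X s \<omega> else 0) \<partial>M) = 0"
    "integrable M (\<lambda>\<omega>. if P \<omega> then X t \<omega> - X s \<omega> else 0)"
    unfolding * using int mg by auto
qed

text \<open>Taking expectations in \<open>pathwise_Doob\<close> for the absolute values leaves only
  the two squares, because every summand has nonnegative mean. The constant 4 is the denominator
  there.\<close>

lemma Doob_L2_grid:
  assumes X: "martingale M F X" and t: "0 \<le> t" "0 < k"
    and sq: "\<And>u. 0 \<le> u \<Longrightarrow> u \<le> t \<Longrightarrow> integrable M (\<lambda>\<omega>. (X u \<omega>)\<^sup>2)"
  defines "m \<equiv> \<lambda>j \<omega>. Max ((\<lambda>i. \<bar>X (grid 0 t k i) \<omega>\<bar>) ` {..j})"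
  shows "integrable M (\<lambda>\<omega>. (m k \<omega>)\<^sup>2)"
    and "(\<integral>\<omega>. (m k \<omega>)\<^sup>2 \<partial>M) \<le> 4 * (\<integral>\<omega>. (X t \<omega>)\<^sup>2 \<partial>M)"
proof -
  define \<tau> where "\<tau> = grid 0 t k"
  have \<tau>: "0 \<le> \<tau> i" "\<tau> i \<le> \<tau> (Suc i)" for i
    unfolding \<tau>_def using t by (auto simp: grid_ge grid_mono)
  have \<tau>_le: "\<tau> i \<le> t" if "i \<le> k" for i
    unfolding \<tau>_def using t that by (auto simp: grid_le)
  have adX: "X u \<in> borel_measurable (F u)" if "0 \<le> u" for u
    using X that by (auto simp: martingale_def adapted_def)
  then have [measurable]: "X (\<tau> i) \<in> borel_measurable M" for i
    using borel_measurable_F \<tau> by blast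
  have adX': "X (\<tau> i) \<in> borel_measurable (F (\<tau> j))" if "i \<le> j" for i j
    using that t unfolding \<tau>_def
    by (intro borel_measurable_F_mono[OF _ _ adX]) (auto simp: grid_ge grid_mono)
  have m_F: "m j \<in> borel_measurable (F (\<tau> j))" for j
  proof -
    have [measurable]: "X (\<tau> i) \<in> borel_measurable (F (\<tau> j))" if "i \<in> {..j}" for i
      using that by (intro adX') auto
    show ?thesis
      unfolding m_def \<tau>_def[symmetric] by (intro borel_measurable_Max) auto
  qed
  then have [measurable]: "m j \<in> borel_measurable M" for j
    using borel_measurable_F \<tau> by blast
  have m_ge: "\<bar>X (\<tau> i) \<omega>\<bar> \<le> m j \<omega>" if "i \<le> j" for i j \<omega>
    unfolding m_def \<tau>_def[symmetric] using that by (intro Max_ge) auto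
  have m_nonneg: "0 \<le> m j \<omega>" for j \<omega>
    using m_ge[of 0 j \<omega>] by simp
  have m_sq: "(m j \<omega>)\<^sup>2 \<le> (\<Sum>i\<le>j. (X (\<tau> i) \<omega>)\<^sup>2)" for j \<omega>
  proof -
    have "m j \<omega> \<in> (\<lambda>i. \<bar>X (\<tau> i) \<omega>\<bar>) ` {..j}"
      unfolding m_def \<tau>_def[symmetric] by (intro Max_in) auto
    then obtain i where i: "i \<le> j" "m j \<omega> = \<bar>X (\<tau> i) \<omega>\<bar>" by auto
    then have "(m j \<omega>)\<^sup>2 = (X (\<tau> i) \<omega>)\<^sup>2" by simp
    also have "\<dots> \<le> (\<Sum>i\<le>j. (X (\<tau> i) \<omega>)\<^sup>2)"
      using i by (intro member_le_sum) auto
    finally show ?thesis .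
  qed
  have int_m: "integrable M (\<lambda>\<omega>. (m j \<omega>)\<^sup>2)" if "j \<le> k" for j
  proof (rule Bochner_Integration.integrable_bound)
    show "integrable M (\<lambda>\<omega>. \<Sum>i\<le>j. (X (\<tau> i) \<omega>)\<^sup>2)"
      using that \<tau> \<tau>_le by (intro Bochner_Integration.integrable_sum sq) auto
  qed (use m_sq in \<open>auto intro!: AE_I2 simp: sum_nonneg\<close>)
  show "integrable M (\<lambda>\<omega>. (m k \<omega>)\<^sup>2)" by (rule int_m) simp
  have int_prod: "integrable M (\<lambda>\<omega>. h \<omega> * X (\<tau> i) \<omega>)"
    if "j \<le> k" "i \<le> k" and [measurable]: "h \<in> borel_measurable M" and h: "\<And>\<omega>. \<bar>h \<omega>\<bar> \<le> m j \<omega>" for h i j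
  proof (rule Bochner_Integration.integrable_bound)
    show "integrable M (\<lambda>\<omega>. (m j \<omega>)\<^sup>2 + (X (\<tau> i) \<omega>)\<^sup>2)"
      using that \<tau> \<tau>_le by (intro Bochner_Integration.integrable_add sq int_m) auto
    have "\<bar>h \<omega> * X (\<tau> i) \<omega>\<bar> \<le> (m j \<omega>)\<^sup>2 + (X (\<tau> i) \<omega>)\<^sup>2" for \<omega>
    proof -
      have "\<bar>h \<omega> * X (\<tau> i) \<omega>\<bar> \<le> m j \<omega> * \<bar>X (\<tau> i) \<omega>\<bar>"
        unfolding abs_mult by (intro mult_right_mono h) auto
      also have "\<dots> \<le> (m j \<omega>)\<^sup>2 + (X (\<tau> i) \<omega>)\<^sup>2"
      proof -
        have "0 \<le> m j \<omega> * \<bar>X (\<tau> i) \<omega>\<bar>" by (simp add: m_nonneg)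
        moreover have "2 * (m j \<omega> * \<bar>X (\<tau> i) \<omega>\<bar>) \<le> (m j \<omega>)\<^sup>2 + (X (\<tau> i) \<omega>)\<^sup>2"
          using sum_squares_bound[of "m j \<omega>" "\<bar>X (\<tau> i) \<omega>\<bar>"] by (simp add: mult.assoc)
        ultimately show ?thesis by linarith
      qed
      finally show ?thesis .
    qed
    then show "AE \<omega> in M. norm (h \<omega> * X (\<tau> i) \<omega>) \<le> norm ((m j \<omega>)\<^sup>2 + (X (\<tau> i) \<omega>)\<^sup>2)"
      by (auto intro!: AE_I2 order_trans[OF _ abs_ge_self])
  qed measurable
  have int_abs: "integrable M (\<lambda>\<omega>. m j \<omega> * \<bar>X (\<tau> i) \<omega>\<bar>)" if "j \<le> k" "i \<le> k" for i j
  proof -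
    have "integrable M (\<lambda>\<omega>. \<bar>m j \<omega> * X (\<tau> i) \<omega>\<bar>)"
      by (intro integrable_abs int_prod[OF that]) (auto simp: m_nonneg)
    then show ?thesis by (simp add: abs_mult m_nonneg)
  qed
  have pos: "0 \<le> (\<integral>\<omega>. m j \<omega> * (\<bar>X (\<tau> (Suc j)) \<omega>\<bar> - \<bar>X (\<tau> j) \<omega>\<bar>) \<partial>M)" if "j < k" for j
  proof -
    \<comment> \<open>The sign as a multiplier replaces the submartingale property of the absolute
      value: \<open>f * X\<close> equals \<open>m j\<close> times the absolute value at time
      \<open>\<tau> j\<close> and is at most that product at the next time.\<close>
    define f where "f \<omega> = m j \<omega> * sgn (X (\<tau> j) \<omega>)" for \<omega>
    have sg: "\<bar>sgn x\<bar> \<le> 1" for x :: real by (simp add: sgn_if)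
    have fF: "f \<in> borel_measurable (F (\<tau> j))"
      unfolding f_def using m_F[of j] adX'[of j j] by measurable
    then have [measurable]: "f \<in> borel_measurable M" using borel_measurable_F \<tau> by blast
    have fm: "\<bar>f \<omega>\<bar> \<le> m j \<omega>" for \<omega>
      unfolding f_def abs_mult using mult_left_mono[OF sg m_nonneg] m_nonneg by auto
    have int: "integrable M (\<lambda>\<omega>. f \<omega> * X (\<tau> (Suc j)) \<omega>)"
      using that by (intro int_prod[of j] fm) auto
    note mg = martingale_integral_mult[OF X \<tau> fF int]
    have "0 = (\<integral>\<omega>. f \<omega> * X (\<tau> (Suc j)) \<omega> - f \<omega> * X (\<tau> j) \<omega> \<partial>M)"
      using int mg by (subst Bochner_Integration.integral_diff) auto
    also have "\<dots> \<le> (\<integral>\<omega>. m j \<omega> * \<bar>X (\<tau> (Suc j)) \<omega>\<bar> - m j \<omega> * \<bar>X (\<tau> j) \<omega>\<bar> \<partial>M)"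
    proof (rule integral_mono)
      show "f \<omega> * X (\<tau> (Suc j)) \<omega> - f \<omega> * X (\<tau> j) \<omega> \<le> m j \<omega> * \<bar>X (\<tau> (Suc j)) \<omega>\<bar> - m j \<omega> * \<bar>X (\<tau> j) \<omega>\<bar>" for \<omega>
      proof -
        have "f \<omega> * X (\<tau> j) \<omega> = m j \<omega> * \<bar>X (\<tau> j) \<omega>\<bar>"
          by (simp add: f_def abs_sgn mult.commute)
        moreover have "f \<omega> * X (\<tau> (Suc j)) \<omega> \<le> m j \<omega> * \<bar>X (\<tau> (Suc j)) \<omega>\<bar>"
          using mult_right_mono[OF fm abs_ge_zero, of \<omega> "X (\<tau> (Suc j)) \<omega>"]
          by (metis abs_ge_self abs_mult order_trans)
        ultimately show ?thesis by simp
      qed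
    qed (use int mg int_abs that in auto)
    finally show ?thesis by (simp add: right_diff_distrib)
  qed
  have int_inc: "integrable M (\<lambda>\<omega>. m j \<omega> * (\<bar>X (\<tau> (Suc j)) \<omega>\<bar> - \<bar>X (\<tau> j) \<omega>\<bar>))" if "j < k" for j
    using int_abs[of j "Suc j"] int_abs[of j j] that by (simp add: right_diff_distrib)
  have Xk: "X (\<tau> k) = X t" using t by (simp add: \<tau>_def)
  have "(\<integral>\<omega>. (\<Sum>j<k. m j \<omega> * (\<bar>X (\<tau> (Suc j)) \<omega>\<bar> - \<bar>X (\<tau> j) \<omega>\<bar>)) + (m k \<omega>)\<^sup>2 / 4 \<partial>M)
      \<le> (\<integral>\<omega>. (X t \<omega>)\<^sup>2 \<partial>M)"
  proof (rule integral_mono)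
    show "(\<Sum>j<k. m j \<omega> * (\<bar>X (\<tau> (Suc j)) \<omega>\<bar> - \<bar>X (\<tau> j) \<omega>\<bar>)) + (m k \<omega>)\<^sup>2 / 4 \<le> (X t \<omega>)\<^sup>2" for \<omega>
      using pathwise_Doob[of "\<lambda>i. \<bar>X (\<tau> i) \<omega>\<bar>" k] by (simp add: m_def \<tau>_def[symmetric] Xk)
  qed (use int_inc int_m[of k] sq[of t] t in \<open>auto intro!: Bochner_Integration.integrable_add\<close>)
  moreover have "(\<integral>\<omega>. (\<Sum>j<k. m j \<omega> * (\<bar>X (\<tau> (Suc j)) \<omega>\<bar> - \<bar>X (\<tau> j) \<omega>\<bar>)) + (m k \<omega>)\<^sup>2 / 4 \<partial>M)
      = (\<Sum>j<k. \<integral>\<omega>. m j \<omega> * (\<bar>X (\<tau> (Suc j)) \<omega>\<bar> - \<bar>X (\<tau> j) \<omega>\<bar>) \<partial>M) + (\<integral>\<omega>. (m k \<omega>)\<^sup>2 \<partial>M) / 4"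
    using int_inc int_m[of k]
    by (subst Bochner_Integration.integral_add) (auto intro!: Bochner_Integration.integrable_sum Bochner_Integration.integral_sum)
  moreover have "0 \<le> (\<Sum>j<k. \<integral>\<omega>. m j \<omega> * (\<bar>X (\<tau> (Suc j)) \<omega>\<bar> - \<bar>X (\<tau> j) \<omega>\<bar>) \<partial>M)"
    using pos by (intro sum_nonneg) auto
  ultimately show "(\<integral>\<omega>. (m k \<omega>)\<^sup>2 \<partial>M) \<le> 4 * (\<integral>\<omega>. (X t \<omega>)\<^sup>2 \<partial>M)"
    by linarith
qed

end

section \<open>Continuous local martingales with nonrandom quadratic variation\<close>

lemma stopped_eq_self: "0 \<le> t \<Longrightarrow> ennreal t \<le> T \<omega> \<Longrightarrow> stopped X T t \<omega> = X t \<omega>"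
  by (simp add: stopped_def min_def)

lemma enn2real_min_bounds:
  assumes "0 \<le> t"
  shows "0 \<le> enn2real (min (ennreal t) a)" "enn2real (min (ennreal t) a) \<le> t"
proof -
  have "enn2real (min (ennreal t) a) \<le> enn2real (ennreal t)"
    by (intro enn2real_mono) auto
  then show "enn2real (min (ennreal t) a) \<le> t" using assms by simp
qed simp

text \<open>\<open>j k\<close> is the first grid index whose time has reached \<open>a\<close>, or
  \<open>k\<close> if none has. The grid time then overshoots the capped time by at most one
  step.\<close>

lemma grid_stopping_tendsto:
  fixes a :: ennreal
  assumes t: "0 \<le> t" and j: "\<And>k. j k \<le> k" "\<And>k i. i < j k \<Longrightarrow> \<not> a \<le> ennreal (grid 0 t k i)"
    "\<And>k. j k < k \<Longrightarrow> a \<le> ennreal (grid 0 t k (j k))"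
  shows "(\<lambda>k. grid 0 t k (j k)) \<longlonglongrightarrow> enn2real (min (ennreal t) a)"
proof -
  define u where "u = enn2real (min (ennreal t) a)"
  have "\<bar>grid 0 t k (j k) - u\<bar> \<le> t / real k" if k: "0 < k" for k
  proof (cases "ennreal t < a")
    case True
    have "j k = k"
    proof (rule ccontr)
      assume "j k \<noteq> k"
      then have "a \<le> ennreal (grid 0 t k (j k))" using j(1,3)[of k] by simp
      also have "\<dots> \<le> ennreal t" using t j(1)[of k] by (intro ennreal_leI grid_le)
      finally show False using True by simp
    qed
    then show ?thesis using True k t by (simp add: u_def min_absorb1 less_imp_le)
  next
    case False
    then have "a \<le> ennreal t" by simp
    then have "a = ennreal u"
      by (cases a) (auto simp: u_def min_absorb2 top_unique)
    moreover have "0 \<le> u" "u \<le> t"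
      unfolding u_def using t by (rule enn2real_min_bounds)+
    ultimately have a: "a = ennreal u" "0 \<le> u" "u \<le> t" by auto
    have up: "u \<le> grid 0 t k (j k)"
    proof (cases "j k < k")
      case True
      then show ?thesis using j(3)[OF True] a t by (simp add: grid_ge)
    next
      case False
      then have "j k = k" using j(1)[of k] by simp
      then show ?thesis using a k by simp
    qed
    show ?thesis
    proof (cases "j k")
      case 0
      then show ?thesis using up a t by simp
    next
      case (Suc i)
      then have "\<not> a \<le> ennreal (grid 0 t k i)" using j(2)[of i k] by simp
      then have "grid 0 t k i < u" using a t by (simp add: grid_ge not_le)
      then show ?thesis using up Suc grid_Suc_diff[of 0 t k i] by simp
    qed
  qed
  then have "(\<lambda>k. grid 0 t k (j k) - u) \<longlonglongrightarrow> 0"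
    by (intro Lim_null_comparison[OF _ grid_width_tendsto_0[of t]])
      (auto intro!: eventually_mono[OF eventually_gt_at_top[of 0]])
  then show ?thesis
    unfolding u_def[symmetric] using Lim_null by blast
qed

text \<open>A stopped path evaluates \<open>X\<close> at a time in \<open>{0..t}\<close>, so
  \<open>D t\<close> dominates all stopped values at once, and equality of the integrals over events
  of \<open>F s\<close> survives the limit along the localising sequence.\<close>

lemma (in complete_stochastic_basis) dominated_local_martingale:
  assumes X: "local_martingale M F X"
    and D: "\<And>t. 0 \<le> t \<Longrightarrow> integrable M (D t)"
      "\<And>t. 0 \<le> t \<Longrightarrow> AE \<omega> in M. \<forall>u\<in>{0..t}. \<bar>X u \<omega>\<bar> \<le> D t \<omega>"
  shows "martingale M F X"
proof -
  from X obtain T where ad: "adapted F X"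
    and T: "AE \<omega> in M. incseq (\<lambda>n. T n \<omega>) \<and> (\<lambda>n. T n \<omega>) \<longlonglongrightarrow> \<infinity>"
      "\<And>n. martingale M F (stopped X (T n))"
    unfolding local_martingale_def by blast
  have XM[measurable]: "X t \<in> borel_measurable M" if "0 \<le> t" for t
    using that ad by (auto intro: borel_measurable_F simp: adapted_def)
  have int: "integrable M (X t)" if "0 \<le> t" for t
  proof (rule Bochner_Integration.integrable_bound[OF D(1)[OF that]])
    show "AE \<omega> in M. norm (X t \<omega>) \<le> norm (D t \<omega>)"
      using D(2)[OF that] by eventually_elim (use that in \<open>force intro: order_trans[OF _ abs_ge_self]\<close>)
  qed (use that in measurable)
  have conv: "AE \<omega> in M. (\<lambda>n. stopped X (T n) t \<omega>) \<longlonglongrightarrow> X t \<omega>" if t: "0 \<le> t" for t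
    using T(1)
  proof eventually_elim
    case (elim \<omega>)
    have "eventually (\<lambda>n. ennreal t < T n \<omega>) sequentially"
      using elim by (intro order_tendstoD(1)[of _ \<infinity>]) auto
    then have "eventually (\<lambda>n. stopped X (T n) t \<omega> = X t \<omega>) sequentially"
      by eventually_elim (use t in \<open>auto intro: stopped_eq_self\<close>)
    then show ?case by (rule tendsto_eventually)
  qed
  have lim: "(\<lambda>n. \<integral>\<omega>. indicator A \<omega> * stopped X (T n) t \<omega> \<partial>M) \<longlonglongrightarrow> (\<integral>\<omega>. indicator A \<omega> * X t \<omega> \<partial>M)"
    if t: "0 \<le> t" "t \<le> u" and A[measurable]: "A \<in> sets M" for t u A
  proof (rule integral_dominated_convergence[where w = "D u"])
    have u: "0 \<le> u" using t by simp
    have XT: "stopped X (T n) t \<in> borel_measurable M" for n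
      using T(2)[of n] t by (auto simp: martingale_def)
    then show "(\<lambda>\<omega>. indicator A \<omega> * stopped X (T n) t \<omega>) \<in> borel_measurable M" for n
      by measurable
    show "(\<lambda>\<omega>. indicator A \<omega> * X t \<omega>) \<in> borel_measurable M"
      using t by measurable
    show "integrable M (D u)" using u by (rule D)
    show "AE \<omega> in M. (\<lambda>n. indicator A \<omega> * stopped X (T n) t \<omega>) \<longlonglongrightarrow> indicator A \<omega> * X t \<omega>"
      using conv[OF t(1)] by eventually_elim (auto intro: tendsto_intros)
    show "AE \<omega> in M. norm (indicator A \<omega> * stopped X (T n) t \<omega>) \<le> D u \<omega>" for n
      using D(2)[OF u]
    proof eventually_elim
      case (elim \<omega>)
      have "\<bar>stopped X (T n) t \<omega>\<bar> \<le> D u \<omega>"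
        unfolding stopped_def using elim enn2real_min_bounds[OF t(1), of "T n \<omega>"] t by simp
      then show ?case
        by (auto simp: indicator_def intro: order_trans[OF abs_ge_zero])
    qed
  qed
  have "AE \<omega> in M. real_cond_exp M (F s) (X t) \<omega> = X s \<omega>" if st: "0 \<le> s" "s \<le> t" for s t
  proof -
    interpret s: sigma_finite_subalgebra M "F s"
      by (rule sigma_finite_subalgebra_F[OF st(1)])
    show ?thesis
    proof (rule s.real_cond_exp_charact)
      fix A assume A: "A \<in> sets (F s)"
      then have AM[measurable]: "A \<in> sets M"
        using subalgebra_F[OF st(1)] by (auto simp: subalgebra_def)
      have eq: "(\<integral>\<omega>. indicator A \<omega> * stopped X (T n) s \<omega> \<partial>M) = (\<integral>\<omega>. indicator A \<omega> * stopped X (T n) t \<omega> \<partial>M)" for n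
      proof (rule martingale_integral_mult(2)[OF T(2) st])
        show "indicator A \<in> borel_measurable (F s)" using A by measurable
        have i: "integrable M (stopped X (T n) t)" using T(2)[of n] st by (auto simp: martingale_def)
        show "integrable M (\<lambda>\<omega>. indicator A \<omega> * stopped X (T n) t \<omega>)"
          using integrable_mult_indicator[OF AM i] by simp
      qed
      have "(\<integral>\<omega>. indicator A \<omega> * X s \<omega> \<partial>M) = (\<integral>\<omega>. indicator A \<omega> * X t \<omega> \<partial>M)"
        using lim[of s t A] lim[of t t A] st AM unfolding eq by (intro LIMSEQ_unique) auto
      then show "(LINT \<omega>:A|M. X t \<omega>) = (LINT \<omega>:A|M. X s \<omega>)"
        by (simp add: set_lebesgue_integral_def)
    qed (use st int ad in \<open>auto simp: adapted_def\<close>)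
  qed
  then show ?thesis using ad int unfolding martingale_def by auto
qed

text \<open>\<open>V\<close> and \<open>q\<close> are kept apart because the hypothesis identifies
  them at each time only up to a null set that may depend on the time.\<close>

locale nonrandom_qv = complete_stochastic_basis M F
  for M :: "'a measure" and F :: "real \<Rightarrow> 'a measure" +
  fixes Z V :: "real \<Rightarrow> 'a \<Rightarrow> real" and q :: "real \<Rightarrow> real"
  assumes Z_continuous: "continuous_process M Z"
    and Z_local_martingale: "local_martingale M F Z"
    and Z_starts_at_zero: "starts_at_zero M Z"
    and Z_quadratic_variation: "quadratic_variation M F Z V"
    and V_nonrandom: "\<And>t. 0 \<le> t \<Longrightarrow> AE \<omega> in M. V t \<omega> = q t"
begin

section \<open>The deterministic function \<open>q\<close>\<close>

lemma ae_filter_not_bot: "ae_filter M \<noteq> bot"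
  by (simp add: ae_filter_eq_bot_iff emeasure_space_1)

text \<open>No regularity of \<open>q\<close> is known yet, so agreement at rational times cannot be
  extended through \<open>q\<close>. Instead the path is compared with a second good path that also
  satisfies \<open>V t = q t\<close> at the given time: continuous paths that agree at the rationals
  agree there too.\<close>

lemma AE_V_eq_q: "AE \<omega> in M. \<forall>t\<ge>0. V t \<omega> = q t"
proof -
  let ?good = "\<lambda>\<omega>. continuous_on {0..} (\<lambda>t. V t \<omega>) \<and> (\<forall>r\<in>\<rat> \<inter> {0..}. V r \<omega> = q r)"
  have "AE \<omega> in M. \<forall>r\<in>\<rat> \<inter> {0..}. V r \<omega> = q r"
    by (subst AE_ball_countable) (auto intro: V_nonrandom countable_subset[OF _ countable_rat])
  then have good: "AE \<omega> in M. ?good \<omega>"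
    using Z_quadratic_variation by (auto simp: quadratic_variation_def continuous_process_def)
  show ?thesis
    using good
  proof eventually_elim
    case (elim \<omega>0)
    show ?case
    proof (intro allI impI)
      fix t :: real assume t: "0 \<le> t"
      have "AE \<omega> in M. ?good \<omega> \<and> V t \<omega> = q t"
        using good V_nonrandom[OF t] by auto
      then have "\<exists>\<omega>. ?good \<omega> \<and> V t \<omega> = q t"
        using eventually_happens'[OF ae_filter_not_bot] by blast
      then obtain \<omega>1 where w: "?good \<omega>1" "V t \<omega>1 = q t" by blast
      \<comment> \<open>Approximation from the right keeps the rationals nonnegative even for
        \<open>t = 0\<close>.\<close>
      have "\<forall>n. \<exists>r\<in>\<rat>. t < r \<and> r < t + 1 / real (Suc n)"
        by (intro allI Rats_dense_in_real) simp
      then obtain r where r: "\<And>n. r n \<in> \<rat>" "\<And>n. t < r n" "\<And>n. r n < t + 1 / real (Suc n)"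
        by metis
      have rt: "r \<longlonglongrightarrow> t"
      proof (rule real_tendsto_sandwich[where f = "\<lambda>_. t"])
        show "(\<lambda>n. t + 1 / real (Suc n)) \<longlonglongrightarrow> t"
          using tendsto_add[OF tendsto_const[of t] LIMSEQ_inverse_real_of_nat] by (simp add: inverse_eq_divide)
      qed (use r in \<open>auto intro!: always_eventually less_imp_le simp del: of_nat_Suc\<close>)
      have r0: "0 \<le> r n" for n using t r(2)[of n] by simp
      have lim: "(\<lambda>n. V (r n) \<omega>) \<longlonglongrightarrow> V t \<omega>" if "continuous_on {0..} (\<lambda>t. V t \<omega>)" for \<omega>
        using r0 t by (intro continuous_on_tendsto_compose[OF that rt]) auto
      have "V (r n) \<omega>0 = V (r n) \<omega>1" for n
        using elim w r t order_trans[OF t less_imp_le[OF r(2)[of n]]] by auto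
      then have "V t \<omega>0 = V t \<omega>1"
        using lim[of \<omega>0] lim[of \<omega>1] elim w LIMSEQ_unique by auto
      then show "V t \<omega>0 = q t" using w by simp
    qed
  qed
qed

text \<open>One outcome with a good path of \<open>V\<close> suffices, since \<open>q\<close>
  coincides with that path on the half-line.\<close>

lemma q_continuous: "continuous_on {0..} q"
  and q_mono: "\<And>s t. 0 \<le> s \<Longrightarrow> s \<le> t \<Longrightarrow> q s \<le> q t"
  and q_0: "q 0 = 0"
proof -
  have "AE \<omega> in M. (\<forall>t\<ge>0. V t \<omega> = q t) \<and> continuous_on {0..} (\<lambda>t. V t \<omega>) \<and>
      mono_on {0..} (\<lambda>t. V t \<omega>) \<and> V 0 \<omega> = 0"
    using AE_V_eq_q Z_quadratic_variation
    by (auto simp: quadratic_variation_def continuous_process_def starts_at_zero_def)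
  then obtain \<omega> where w: "\<forall>t\<ge>0. V t \<omega> = q t" "continuous_on {0..} (\<lambda>t. V t \<omega>)"
      "mono_on {0..} (\<lambda>t. V t \<omega>)" "V 0 \<omega> = 0"
    using eventually_happens'[OF ae_filter_not_bot] by blast
  show "continuous_on {0..} q"
    using w(1,2) by (subst continuous_on_cong[of _ _ _ "\<lambda>t. V t \<omega>"]) auto
  show "q s \<le> q t" if "0 \<le> s" "s \<le> t" for s t
    using w(1) mono_onD[OF w(3), of s t] that by auto
  show "q 0 = 0" using w by auto
qed

lemma q_nonneg: "0 \<le> t \<Longrightarrow> 0 \<le> q t"
  using q_mono[of 0 t] q_0 by simp

lemma Z_measurable_F: "0 \<le> t \<Longrightarrow> Z t \<in> borel_measurable (F t)"
  using Z_local_martingale by (simp add: local_martingale_def adapted_def)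

lemma Z_measurable [measurable]: "0 \<le> t \<Longrightarrow> Z t \<in> borel_measurable M"
  using borel_measurable_F Z_measurable_F by blast

text \<open>Optional stopping in the form of an inequality. The stopping time is approximated by grid
  times; Fatou's lemma replaces uniform integrability because \<open>Z\<^sup>2\<close> is nonnegative and \<open>V\<close> is
  bounded by \<open>q t\<close> up to time \<open>t\<close>.\<close>

lemma nn_integral_stopped_square_le:
  assumes T: "ext_stopping_time F T" and t: "0 \<le> t"
  shows "(\<integral>\<^sup>+\<omega>. ennreal ((stopped Z T t \<omega>)\<^sup>2) \<partial>M) \<le> ennreal (q t)"
proof -
  define Y where "Y t \<omega> = (Z t \<omega>)\<^sup>2 - V t \<omega>" for t \<omega>
  have "local_martingale M F Y"
    using Z_quadratic_variation by (simp add: quadratic_variation_def Y_def[abs_def])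
  \<comment> \<open>\<open>R\<close> localises the compensated square and has no relation to
    \<open>T\<close>; the two stops have to be combined.\<close>
  then obtain R where R: "AE \<omega> in M. incseq (\<lambda>n. R n \<omega>) \<and> (\<lambda>n. R n \<omega>) \<longlonglongrightarrow> \<infinity>"
      "\<And>n. martingale M F (stopped Y (R n))"
    unfolding local_martingale_def by blast
  define \<tau> where "\<tau> = grid 0 t"
  have \<tau>: "0 \<le> \<tau> k i" "\<tau> k i \<le> \<tau> k (Suc i)" for k i
    unfolding \<tau>_def using t by (auto simp: grid_ge grid_mono)
  have \<tau>_le: "\<tau> k i \<le> t" if "i \<le> k" for k i
    unfolding \<tau>_def using t that by (auto simp: grid_le)
  define b where "b k i \<omega> \<longleftrightarrow> \<not> T \<omega> \<le> ennreal (\<tau> k i)" for k i \<omega>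
  \<comment> \<open>The index \<open>k\<close> is both the number of grid steps and the index of
    localisation, so a single limit handles both.\<close>
  define y where "y k i \<omega> = stopped Y (R k) (\<tau> k i) \<omega>" for k i \<omega>
  define U where "U k \<omega> = (\<Sum>i<k. if b k i \<omega> then y k (Suc i) \<omega> - y k i \<omega> else 0)" for k \<omega>
  have b: "Measurable.pred (F (\<tau> k i)) (b k i)" for k i
  proof -
    have "Measurable.pred (F (\<tau> k i)) (\<lambda>\<omega>. T \<omega> \<le> ennreal (\<tau> k i))"
      using T \<tau>(1)[of k i] by (simp add: ext_stopping_time_def)
    then have "Measurable.pred (F (\<tau> k i)) (\<lambda>\<omega>. \<not> T \<omega> \<le> ennreal (\<tau> k i))"
      by (rule pred_intros_logic)
    then show ?thesis unfolding b_def[abs_def] .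
  qed
  note inc = martingale_integral_indicator[OF R(2) \<tau> b]
  have U_int: "integrable M (U k)" for k
    unfolding U_def y_def by (intro Bochner_Integration.integrable_sum inc(2))
  have U_0: "(\<integral>\<omega>. U k \<omega> \<partial>M) = 0" for k
    unfolding U_def y_def by (subst Bochner_Integration.integral_sum[OF inc(2)]) (simp add: inc(1))
  \<comment> \<open>\<open>J k\<close> is chosen outcome by outcome and never shown to be
    measurable; only \<open>U k\<close> is integrated.\<close>
  define J where "J k \<omega> = (SOME j. j \<le> k \<and> U k \<omega> = y k j \<omega> - y k 0 \<omega> \<and> (\<forall>i<j. b k i \<omega>) \<and> (j < k \<longrightarrow> \<not> b k j \<omega>))" for k \<omega>
  have J_ex: "\<exists>j. j \<le> k \<and> U k \<omega> = y k j \<omega> - y k 0 \<omega> \<and> (\<forall>i<j. b k i \<omega>) \<and> (j < k \<longrightarrow> \<not> b k j \<omega>)" for k \<omega>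
  proof -
    have "b k i \<omega>" if "i \<le> j" "b k j \<omega>" for i j
    proof -
      have "ennreal (\<tau> k i) \<le> ennreal (\<tau> k j)"
        unfolding \<tau>_def by (intro ennreal_leI grid_mono t that)
      then show ?thesis using that(2) unfolding b_def by (meson order_trans)
    qed
    then have "\<exists>j\<le>k. U k \<omega> = y k j \<omega> - y k 0 \<omega> \<and> (\<forall>i<j. b k i \<omega>) \<and> (j < k \<longrightarrow> \<not> b k j \<omega>)"
      unfolding U_def by (rule stopped_sum)
    then show ?thesis by blast
  qed
  then have Jc: "J k \<omega> \<le> k \<and> U k \<omega> = y k (J k \<omega>) \<omega> - y k 0 \<omega> \<and> (\<forall>i<J k \<omega>. b k i \<omega>) \<and>
      (J k \<omega> < k \<longrightarrow> \<not> b k (J k \<omega>) \<omega>)" for k \<omega>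
    unfolding J_def by (rule someI_ex)
  have J: "J k \<omega> \<le> k" "U k \<omega> = y k (J k \<omega>) \<omega> - y k 0 \<omega>" "\<And>i. i < J k \<omega> \<Longrightarrow> b k i \<omega>"
      "J k \<omega> < k \<Longrightarrow> \<not> b k (J k \<omega>) \<omega>" for k \<omega>
    using Jc[of k \<omega>] by blast+
  define \<rho> where "\<rho> k \<omega> = enn2real (min (ennreal (\<tau> k (J k \<omega>))) (R k \<omega>))" for k \<omega>
  have \<rho>: "0 \<le> \<rho> k \<omega>" "\<rho> k \<omega> \<le> t" for k \<omega>
    unfolding \<rho>_def using enn2real_min_bounds[OF \<tau>(1)] \<tau>_le[OF J(1)] order_trans by blast+
  have key: "AE \<omega> in M. (\<forall>k. (Z (\<rho> k \<omega>) \<omega>)\<^sup>2 \<le> U k \<omega> + q t) \<and>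
      (\<lambda>k. (Z (\<rho> k \<omega>) \<omega>)\<^sup>2) \<longlonglongrightarrow> (stopped Z T t \<omega>)\<^sup>2"
    using R(1) AE_V_eq_q Z_continuous[unfolded continuous_process_def] Z_starts_at_zero[unfolded starts_at_zero_def]
  proof eventually_elim
    case (elim \<omega>)
    have "(Z (\<rho> k \<omega>) \<omega>)\<^sup>2 \<le> U k \<omega> + q t" for k
    proof -
      have "y k 0 \<omega> = 0"
        using elim q_0 by (simp add: y_def \<tau>_def stopped_def Y_def)
      then have "U k \<omega> = (Z (\<rho> k \<omega>) \<omega>)\<^sup>2 - q (\<rho> k \<omega>)"
        using J(2)[of k \<omega>] elim \<rho>[of k \<omega>] by (simp add: y_def stopped_def Y_def \<rho>_def)
      then show ?thesis using q_mono[OF \<rho>(1,2)] by (simp add: add_diff_eq)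
    qed
    moreover have "(\<lambda>k. (Z (\<rho> k \<omega>) \<omega>)\<^sup>2) \<longlonglongrightarrow> (stopped Z T t \<omega>)\<^sup>2"
    proof -
      have lim: "(\<lambda>k. \<tau> k (J k \<omega>)) \<longlonglongrightarrow> enn2real (min (ennreal t) (T \<omega>))"
        using J(1,3,4) unfolding \<tau>_def b_def by (intro grid_stopping_tendsto[OF t]) blast+
      have "eventually (\<lambda>k. ennreal t < R k \<omega>) sequentially"
        using elim by (intro order_tendstoD(1)[of _ \<infinity>]) auto
      then have "eventually (\<lambda>k. \<tau> k (J k \<omega>) = \<rho> k \<omega>) sequentially"
      proof eventually_elim
        case (elim k)
        have "ennreal (\<tau> k (J k \<omega>)) \<le> ennreal t" by (intro ennreal_leI \<tau>_le J)
        also note elim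
        finally show ?case
          using \<tau>(1)[of k "J k \<omega>"] unfolding \<rho>_def by (simp add: min_absorb1 less_imp_le)
      qed
      with lim have "(\<lambda>k. \<rho> k \<omega>) \<longlonglongrightarrow> enn2real (min (ennreal t) (T \<omega>))"
        by (rule Lim_transform_eventually)
      with elim(3) have "(\<lambda>k. Z (\<rho> k \<omega>) \<omega>) \<longlonglongrightarrow> stopped Z T t \<omega>"
        unfolding stopped_def
        by (rule continuous_on_tendsto_compose[where f = "\<lambda>t. Z t \<omega>"]) (auto simp: \<rho>)
      then show ?thesis by (rule tendsto_power)
    qed
    ultimately show ?case by simp
  qed
  \<comment> \<open>Fatou's lemma is applied to \<open>U k + q t\<close>, which is measurable with
    integral exactly \<open>q t\<close>, rather than to the square below it.\<close>
  have "(\<integral>\<^sup>+\<omega>. ennreal ((stopped Z T t \<omega>)\<^sup>2) \<partial>M) \<le> (\<integral>\<^sup>+\<omega>. liminf (\<lambda>k. ennreal (U k \<omega> + q t)) \<partial>M)"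
  proof (rule nn_integral_mono_AE)
    show "AE \<omega> in M. ennreal ((stopped Z T t \<omega>)\<^sup>2) \<le> liminf (\<lambda>k. ennreal (U k \<omega> + q t))"
      using key
    proof eventually_elim
      case (elim \<omega>)
      have "ennreal ((stopped Z T t \<omega>)\<^sup>2) = liminf (\<lambda>k. ennreal ((Z (\<rho> k \<omega>) \<omega>)\<^sup>2))"
        using elim by (intro lim_imp_Liminf[symmetric] tendsto_ennrealI) auto
      also have "\<dots> \<le> liminf (\<lambda>k. ennreal (U k \<omega> + q t))"
        using elim by (intro Liminf_mono always_eventually allI ennreal_leI) auto
      finally show ?case .
    qed
  qed
  also have "\<dots> \<le> liminf (\<lambda>k. \<integral>\<^sup>+\<omega>. ennreal (U k \<omega> + q t) \<partial>M)"
    using U_int by (intro nn_integral_liminf) auto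
  also have "(\<lambda>k. \<integral>\<^sup>+\<omega>. ennreal (U k \<omega> + q t) \<partial>M) = (\<lambda>k. ennreal (q t))"
  proof
    fix k
    have "AE \<omega> in M. 0 \<le> U k \<omega> + q t"
      using key by eventually_elim (meson order_trans zero_le_power2)
    then have "(\<integral>\<^sup>+\<omega>. ennreal (U k \<omega> + q t) \<partial>M) = ennreal (\<integral>\<omega>. U k \<omega> + q t \<partial>M)"
      using U_int by (intro nn_integral_eq_integral) auto
    then show "(\<integral>\<^sup>+\<omega>. ennreal (U k \<omega> + q t) \<partial>M) = ennreal (q t)"
      using U_int U_0 by (simp add: prob_space)
  qed
  finally show ?thesis by (simp add: Liminf_const)
qed

text \<open>The dominating variable is the lower limit of the grid maxima of \<open>Z\<^sup>2\<close>: it bounds the supremum by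
  continuity, and Doob's inequality with Fatou's lemma bounds its expectation.\<close>

lemma dominating_square:
  assumes t: "0 \<le> t"
  obtains S where "integrable M S" "AE \<omega> in M. \<forall>u\<in>{0..t}. (Z u \<omega>)\<^sup>2 \<le> S \<omega>"
proof -
  from Z_local_martingale obtain T where
    T: "\<And>n. ext_stopping_time F (T n)" "AE \<omega> in M. incseq (\<lambda>n. T n \<omega>) \<and> (\<lambda>n. T n \<omega>) \<longlonglongrightarrow> \<infinity>"
      "\<And>n. martingale M F (stopped Z (T n))"
    unfolding local_martingale_def by blast
  define X where "X n = stopped Z (T n)" for n
  have X_meas[measurable]: "X n u \<in> borel_measurable M" if "0 \<le> u" for n u
    using T(3)[of n] that by (auto simp: martingale_def X_def)
  have X_sq: "integrable M (\<lambda>\<omega>. (X n u \<omega>)\<^sup>2)" "(\<integral>\<omega>. (X n u \<omega>)\<^sup>2 \<partial>M) \<le> q u" if "0 \<le> u" for n u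
  proof -
    have le: "(\<integral>\<^sup>+\<omega>. ennreal ((X n u \<omega>)\<^sup>2) \<partial>M) \<le> ennreal (q u)"
      unfolding X_def by (rule nn_integral_stopped_square_le[OF T(1) that])
    then show int: "integrable M (\<lambda>\<omega>. (X n u \<omega>)\<^sup>2)"
      using that by (intro integrableI_bounded) (auto simp: le_less_trans[OF _ ennreal_less_top])
    show "(\<integral>\<omega>. (X n u \<omega>)\<^sup>2 \<partial>M) \<le> q u"
      using le q_nonneg[OF that] by (subst (asm) nn_integral_eq_integral[OF int]) auto
  qed
  \<comment> \<open>Again one index: the process stopped at \<open>T n\<close> is sampled on the
    grid with \<open>n\<close> steps. Almost surely the stop eventually lies beyond
    \<open>t\<close>, and the maxima then see \<open>Z\<close> itself.\<close>
  define m where "m n \<omega> = Max ((\<lambda>i. \<bar>X n (grid 0 t n i) \<omega>\<bar>) ` {..n})" for n \<omega>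
  have m_meas[measurable]: "m n \<in> borel_measurable M" for n
    unfolding m_def using t by (intro borel_measurable_Max) (auto simp: grid_ge intro!: borel_measurable_abs X_meas)
  have m_sq: "(\<integral>\<^sup>+\<omega>. ennreal ((m n \<omega>)\<^sup>2) \<partial>M) \<le> ennreal (4 * q t)" if "0 < n" for n
  proof -
    have X: "martingale M F (X n)" using T(3) by (simp add: X_def)
    note D = Doob_L2_grid[OF X t that X_sq(1), folded m_def]
    have "(\<integral>\<omega>. (m n \<omega>)\<^sup>2 \<partial>M) \<le> 4 * q t"
      using D(2) X_sq(2)[OF t, of n] by simp
    then show ?thesis
      by (subst nn_integral_eq_integral[OF D(1)]) (auto intro: ennreal_leI)
  qed
  define S where "S \<omega> = liminf (\<lambda>n. ennreal ((m n \<omega>)\<^sup>2))" for \<omega>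
  have [measurable]: "S \<in> borel_measurable M" unfolding S_def by measurable
  have "(\<integral>\<^sup>+\<omega>. S \<omega> \<partial>M) \<le> liminf (\<lambda>n. \<integral>\<^sup>+\<omega>. ennreal ((m n \<omega>)\<^sup>2) \<partial>M)"
    unfolding S_def by (intro nn_integral_liminf) auto
  also have "\<dots> \<le> liminf (\<lambda>n::nat. ennreal (4 * q t))"
    using m_sq by (intro Liminf_mono eventually_mono[OF eventually_gt_at_top[of 0]]) auto
  finally have "(\<integral>\<^sup>+\<omega>. S \<omega> \<partial>M) \<le> ennreal (4 * q t)" by (simp add: Liminf_const)
  then have fin: "(\<integral>\<^sup>+\<omega>. S \<omega> \<partial>M) < \<infinity>" by (rule le_less_trans) simp
  then have S_fin: "AE \<omega> in M. S \<omega> \<noteq> \<infinity>" by (intro nn_integral_PInf_AE) auto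
  show thesis
  proof (rule that[of "\<lambda>\<omega>. enn2real (S \<omega>)"])
    show "integrable M (\<lambda>\<omega>. enn2real (S \<omega>))"
    proof (rule integrableI_bounded)
      have "(\<integral>\<^sup>+\<omega>. ennreal (norm (enn2real (S \<omega>))) \<partial>M) \<le> (\<integral>\<^sup>+\<omega>. S \<omega> \<partial>M)"
        by (intro nn_integral_mono) (simp add: ennreal_enn2real_if)
      then show "(\<integral>\<^sup>+\<omega>. ennreal (norm (enn2real (S \<omega>))) \<partial>M) < \<infinity>" using fin by (rule le_less_trans)
    qed measurable
    show "AE \<omega> in M. \<forall>u\<in>{0..t}. (Z u \<omega>)\<^sup>2 \<le> enn2real (S \<omega>)"
      using S_fin T(2) Z_continuous[unfolded continuous_process_def]
    proof eventually_elim
      case (elim \<omega>)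
      show ?case
      proof
        fix u assume u: "u \<in> {0..t}"
        then obtain r where r: "\<And>k. r k \<le> k" "(\<lambda>k. grid 0 t k (r k)) \<longlonglongrightarrow> u"
          using exists_grid_seq[of 0 u t] by auto
        have "(\<lambda>k. Z (grid 0 t k (r k)) \<omega>) \<longlonglongrightarrow> Z u \<omega>"
          using u t by (intro continuous_on_tendsto_compose[OF elim(3) r(2)]) (auto simp: grid_ge)
        then have "ennreal ((Z u \<omega>)\<^sup>2) = liminf (\<lambda>k. ennreal ((Z (grid 0 t k (r k)) \<omega>)\<^sup>2))"
          by (intro lim_imp_Liminf[symmetric] tendsto_ennrealI tendsto_power) auto
        also have "\<dots> \<le> S \<omega>"
          unfolding S_def
        proof (rule Liminf_mono)
          have "eventually (\<lambda>k. ennreal t < T k \<omega>) sequentially"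
            using elim by (intro order_tendstoD(1)[of _ \<infinity>]) auto
          then show "eventually (\<lambda>k. ennreal ((Z (grid 0 t k (r k)) \<omega>)\<^sup>2) \<le> ennreal ((m k \<omega>)\<^sup>2)) sequentially"
          proof eventually_elim
            case (elim k)
            have g: "0 \<le> grid 0 t k (r k)" "grid 0 t k (r k) \<le> t"
              using t r by (auto simp: grid_ge grid_le)
            have "ennreal (grid 0 t k (r k)) \<le> T k \<omega>"
              using elim ennreal_leI[OF g(2)] by (meson less_imp_le order_trans)
            then have "Z (grid 0 t k (r k)) \<omega> = X k (grid 0 t k (r k)) \<omega>"
              unfolding X_def using g by (simp add: stopped_eq_self)
            moreover have "\<bar>X k (grid 0 t k (r k)) \<omega>\<bar> \<le> m k \<omega>"
              unfolding m_def using r(1) by (intro Max_ge) auto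
            ultimately show ?case
              by (intro ennreal_leI) (simp add: abs_le_square_iff[symmetric])
          qed
        qed
        finally have "ennreal ((Z u \<omega>)\<^sup>2) \<le> S \<omega>" .
        then have "enn2real (ennreal ((Z u \<omega>)\<^sup>2)) \<le> enn2real (S \<omega>)"
          using elim by (intro enn2real_mono) (auto simp: top.not_eq_extremum)
        then show "(Z u \<omega>)\<^sup>2 \<le> enn2real (S \<omega>)" by simp
      qed
    qed
  qed
qed

text \<open>One dominating variable serves both: \<open>\<bar>x\<bar> \<le> 1 + x\<^sup>2\<close>
  settles \<open>Z\<close>, and adding \<open>q t\<close> settles the compensated square.\<close>

lemma Z_martingale: "martingale M F Z"
  and Z_square_martingale: "martingale M F (\<lambda>t \<omega>. (Z t \<omega>)\<^sup>2 - V t \<omega>)"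
proof -
  have "\<forall>t. \<exists>S. 0 \<le> t \<longrightarrow> integrable M S \<and> (AE \<omega> in M. \<forall>u\<in>{0..t}. (Z u \<omega>)\<^sup>2 \<le> S \<omega>)"
  proof
    fix t
    show "\<exists>S. 0 \<le> t \<longrightarrow> integrable M S \<and> (AE \<omega> in M. \<forall>u\<in>{0..t}. (Z u \<omega>)\<^sup>2 \<le> S \<omega>)"
      by (cases "0 \<le> t") (auto elim: dominating_square)
  qed
  from choice[OF this] obtain S where
    "\<forall>t. 0 \<le> t \<longrightarrow> integrable M (S t) \<and> (AE \<omega> in M. \<forall>u\<in>{0..t}. (Z u \<omega>)\<^sup>2 \<le> S t \<omega>)" ..
  then have S: "\<And>t. 0 \<le> t \<Longrightarrow> integrable M (S t)"
    "\<And>t. 0 \<le> t \<Longrightarrow> AE \<omega> in M. \<forall>u\<in>{0..t}. (Z u \<omega>)\<^sup>2 \<le> S t \<omega>"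
    by blast+
  show "martingale M F Z"
  proof (rule dominated_local_martingale[OF Z_local_martingale, where D = "\<lambda>t \<omega>. 1 + S t \<omega>"])
    show "AE \<omega> in M. \<forall>u\<in>{0..t}. \<bar>Z u \<omega>\<bar> \<le> 1 + S t \<omega>" if "0 \<le> t" for t
      using S(2)[OF that]
    proof eventually_elim
      case (elim \<omega>)
      have "\<bar>x\<bar> \<le> 1 + x\<^sup>2" for x :: real
        using sum_squares_bound[of 1 "\<bar>x\<bar>"] by (simp add: )
      then show ?case using elim by (meson add_left_mono order_trans)
    qed
  qed (use S in auto)
  show "martingale M F (\<lambda>t \<omega>. (Z t \<omega>)\<^sup>2 - V t \<omega>)"
  proof (rule dominated_local_martingale[where D = "\<lambda>t \<omega>. S t \<omega> + q t"])
    show "AE \<omega> in M. \<forall>u\<in>{0..t}. \<bar>(Z u \<omega>)\<^sup>2 - V u \<omega>\<bar> \<le> S t \<omega> + q t" if "0 \<le> t" for t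
      using S(2)[OF that] AE_V_eq_q
    proof eventually_elim
      case (elim \<omega>)
      show ?case
      proof
        fix u assume u: "u \<in> {0..t}"
        then have "0 \<le> q u" "q u \<le> q t" "(Z u \<omega>)\<^sup>2 \<le> S t \<omega>" "V u \<omega> = q u" "0 \<le> (Z u \<omega>)\<^sup>2"
          using elim by (auto intro: q_mono q_nonneg)
        then show "\<bar>(Z u \<omega>)\<^sup>2 - V u \<omega>\<bar> \<le> S t \<omega> + q t" by linarith
      qed
    qed
  qed (use S Z_quadratic_variation in \<open>auto simp: quadratic_variation_def\<close>)
qed

end

section \<open>The characteristic function of an increment\<close>

definition iexp_rem :: "real \<Rightarrow> complex" where
  "iexp_rem y = iexp y - (1 + \<i> * y - y\<^sup>2 / 2)"

text \<open>The cubic bound gains a factor \<open>e\<close> for increments of size at most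
  \<open>e\<close>; the quadratic one is for the first larger increment.\<close>

lemma iexp_rem_le_cube: "cmod (iexp_rem y) \<le> \<bar>y\<bar> ^ 3 / 6"
  and iexp_rem_le_square: "cmod (iexp_rem y) \<le> y\<^sup>2"
proof -
  have "{..2::nat} = {0, 1, 2}" by auto
  then have *: "iexp_rem y = iexp y - (\<Sum>k\<le>2. (\<i> * y) ^ k / fact k)"
    by (simp add: iexp_rem_def power_mult_distrib)
  show "cmod (iexp_rem y) \<le> \<bar>y\<bar> ^ 3 / 6"
    unfolding * using iexp_approx1[of y 2] by (simp add: numeral_3_eq_3 numeral_2_eq_2)
  show "cmod (iexp_rem y) \<le> y\<^sup>2"
    unfolding * using iexp_approx2[of y 2] by simp
qed

lemma borel_measurable_iexp_rem [measurable]: "iexp_rem \<in> borel_measurable borel"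
  unfolding iexp_rem_def[abs_def] by measurable

text \<open>Compares the second-order factor \<open>1 - x\<close> of one step with the Gaussian
  factor \<open>exp (- x)\<close>. Being quadratic, the errors add up to something that vanishes
  with the mesh.\<close>

lemma exp_minus_quadratic_bound:
  fixes x :: real
  assumes "0 \<le> x"
  shows "\<bar>1 - x - exp (- x)\<bar> \<le> x\<^sup>2"
proof -
  have "1 - x \<le> exp (- x)" using exp_ge_add_one_self[of "- x"] by simp
  moreover have "exp (- x) \<le> 1 - x + x\<^sup>2"
  proof -
    have "exp (- x) \<le> 1 / (1 + x)"
      using exp_ge_add_one_self[of x] assms by (simp add: exp_minus field_simps)
    also have "\<dots> \<le> 1 - x + x\<^sup>2"
    proof -
      \<comment> \<open>The product equals \<open>1 + x ^ 3\<close>.\<close>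
      have "1 \<le> (1 - x + x\<^sup>2) * (1 + x)"
        using assms by (simp add: algebra_simps power2_eq_square)
      then show ?thesis using assms by (simp add: divide_le_eq)
    qed
    finally show ?thesis .
  qed
  ultimately show ?thesis by (simp add: abs_le_iff)
qed

context nonrandom_qv
begin

section \<open>Conditional moments of increments\<close>

lemma Z_integrable: "0 \<le> t \<Longrightarrow> integrable M (Z t)"
  using Z_martingale by (simp add: martingale_def)

lemma Z_square_integrable:
  assumes "0 \<le> t"
  shows "integrable M (\<lambda>\<omega>. (Z t \<omega>)\<^sup>2)"
proof -
  obtain S where S: "integrable M S" "AE \<omega> in M. \<forall>u\<in>{0..t}. (Z u \<omega>)\<^sup>2 \<le> S \<omega>"
    using dominating_square[OF assms] .
  show ?thesis
  proof (rule Bochner_Integration.integrable_bound[OF S(1)])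
    show "AE \<omega> in M. norm ((Z t \<omega>)\<^sup>2) \<le> norm (S \<omega>)"
      using S(2) by eventually_elim (use assms in \<open>force intro: order_trans[OF _ abs_ge_self]\<close>)
  qed (use assms in measurable)
qed

lemma Z_product_integrable:
  assumes "0 \<le> s" "0 \<le> t"
  shows "integrable M (\<lambda>\<omega>. Z s \<omega> * Z t \<omega>)"
proof (rule Bochner_Integration.integrable_bound)
  show "integrable M (\<lambda>\<omega>. (Z s \<omega>)\<^sup>2 + (Z t \<omega>)\<^sup>2)"
    using assms by (intro Bochner_Integration.integrable_add Z_square_integrable)
  show "AE \<omega> in M. norm (Z s \<omega> * Z t \<omega>) \<le> norm ((Z s \<omega>)\<^sup>2 + (Z t \<omega>)\<^sup>2)"
  proof (rule AE_I2)
    fix \<omega>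
    have "2 * (\<bar>Z s \<omega>\<bar> * \<bar>Z t \<omega>\<bar>) \<le> (Z s \<omega>)\<^sup>2 + (Z t \<omega>)\<^sup>2"
      using sum_squares_bound[of "\<bar>Z s \<omega>\<bar>" "\<bar>Z t \<omega>\<bar>"] by (simp add: mult.assoc)
    moreover have "0 \<le> \<bar>Z s \<omega>\<bar> * \<bar>Z t \<omega>\<bar>" by simp
    ultimately have "\<bar>Z s \<omega>\<bar> * \<bar>Z t \<omega>\<bar> \<le> (Z s \<omega>)\<^sup>2 + (Z t \<omega>)\<^sup>2" by linarith
    then show "norm (Z s \<omega> * Z t \<omega>) \<le> norm ((Z s \<omega>)\<^sup>2 + (Z t \<omega>)\<^sup>2)"
      unfolding real_norm_def abs_mult by (rule order_trans[OF _ abs_ge_self])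
  qed
qed (use assms in measurable)

lemma increment_square_integrable:
  assumes "0 \<le> s" "0 \<le> t"
  shows "integrable M (\<lambda>\<omega>. (Z t \<omega> - Z s \<omega>)\<^sup>2)"
proof -
  have "integrable M (\<lambda>\<omega>. (Z t \<omega>)\<^sup>2 + (Z s \<omega>)\<^sup>2 - 2 * (Z t \<omega> * Z s \<omega>))"
    using assms by (intro Bochner_Integration.integrable_add Bochner_Integration.integrable_diff
        integrable_mult_right Z_product_integrable Z_square_integrable)
  then show ?thesis by (simp add: power2_diff mult.assoc)
qed

lemma integrable_bounded_mult:
  fixes h f :: "'a \<Rightarrow> real"
  assumes "integrable M f" "h \<in> borel_measurable M" "\<And>\<omega>. \<bar>h \<omega>\<bar> \<le> 1"
  shows "integrable M (\<lambda>\<omega>. h \<omega> * f \<omega>)"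
proof (rule Bochner_Integration.integrable_bound[OF assms(1)])
  show "AE \<omega> in M. norm (h \<omega> * f \<omega>) \<le> norm (f \<omega>)"
    using mult_right_mono[OF assms(3) abs_ge_zero] by (auto simp: abs_mult)
qed (use assms in measurable)

text \<open>With \<open>Y\<close> the compensated square, \<open>(Z t - Z s)\<^sup>2 = (Y t - Y s) +
  (q t - q s) + 2 * Z s * (Z s - Z t)\<close> almost surely. The martingale differences vanish
  against \<open>h\<close>, and the remaining term is nonrandom, so it leaves the integral.\<close>

lemma increment_moments_real:
  fixes h :: "'a \<Rightarrow> real"
  assumes st: "0 \<le> s" "s \<le> t" and h: "h \<in> borel_measurable (F s)" "\<And>\<omega>. \<bar>h \<omega>\<bar> \<le> 1"
  shows "(\<integral>\<omega>. h \<omega> * (Z t \<omega> - Z s \<omega>) \<partial>M) = 0"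
    and "(\<integral>\<omega>. h \<omega> * (Z t \<omega> - Z s \<omega>)\<^sup>2 \<partial>M) = (q t - q s) * (\<integral>\<omega>. h \<omega> \<partial>M)"
proof -
  have t: "0 \<le> t" using st by simp
  have hM[measurable]: "h \<in> borel_measurable M" using borel_measurable_F[OF st(1) h(1)] .
  have [measurable]: "Z s \<in> borel_measurable M" "Z t \<in> borel_measurable M" using st t by auto
  note bm = integrable_bounded_mult[OF _ hM h(2)]
  define Y where "Y u \<omega> = (Z u \<omega>)\<^sup>2 - V u \<omega>" for u \<omega>
  have Y: "martingale M F Y" using Z_square_martingale by (simp add: Y_def[abs_def])
  then have Yi: "integrable M (Y u)" if "0 \<le> u" for u
    using that by (simp add: martingale_def)
  have i1: "integrable M (\<lambda>\<omega>. h \<omega> * Z t \<omega>)" "integrable M (\<lambda>\<omega>. h \<omega> * Z s \<omega>)"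
    using bm[OF Z_integrable] st t by blast+
  have i2: "integrable M (\<lambda>\<omega>. h \<omega> * Y t \<omega>)" "integrable M (\<lambda>\<omega>. h \<omega> * Y s \<omega>)"
    using bm[OF Yi] st t by blast+
  have i3: "integrable M (\<lambda>\<omega>. h \<omega> * (Z s \<omega> * Z t \<omega>))" "integrable M (\<lambda>\<omega>. h \<omega> * (Z s \<omega> * Z s \<omega>))"
    using bm[OF Z_product_integrable] st t by blast+
  have i4: "integrable M h"
    using h(2) by (intro integrable_const_bound[where B = 1]) auto
  show "(\<integral>\<omega>. h \<omega> * (Z t \<omega> - Z s \<omega>) \<partial>M) = 0"
    using martingale_integral_mult(2)[OF Z_martingale st h(1) i1(1)] i1 by (simp add: right_diff_distrib)
  have m2: "(\<integral>\<omega>. h \<omega> * Y s \<omega> \<partial>M) = (\<integral>\<omega>. h \<omega> * Y t \<omega> \<partial>M)"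
    by (rule martingale_integral_mult(2)[OF Y st h(1) i2(1)])
  \<comment> \<open>The cross term: the martingale property of \<open>Z\<close> is tested with the
    unbounded weight \<open>h * Z s\<close>.\<close>
  have m3: "(\<integral>\<omega>. h \<omega> * (Z s \<omega> * Z s \<omega>) \<partial>M) = (\<integral>\<omega>. h \<omega> * (Z s \<omega> * Z t \<omega>) \<partial>M)"
  proof -
    have hZ: "(\<lambda>\<omega>. h \<omega> * Z s \<omega>) \<in> borel_measurable (F s)"
      using h(1) Z_measurable_F[OF st(1)] by measurable
    have "integrable M (\<lambda>\<omega>. h \<omega> * Z s \<omega> * Z t \<omega>)" using i3(1) by (simp add: mult.assoc)
    from martingale_integral_mult(2)[OF Z_martingale st hZ this] show ?thesis
      by (simp add: mult.assoc)
  qed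
  have "(\<integral>\<omega>. h \<omega> * (Z t \<omega> - Z s \<omega>)\<^sup>2 \<partial>M) =
      (\<integral>\<omega>. ((h \<omega> * Y t \<omega> - h \<omega> * Y s \<omega>) + (q t - q s) * h \<omega>) +
        2 * (h \<omega> * (Z s \<omega> * Z s \<omega>) - h \<omega> * (Z s \<omega> * Z t \<omega>)) \<partial>M)"
  proof (rule integral_cong_AE)
    show "AE \<omega> in M. h \<omega> * (Z t \<omega> - Z s \<omega>)\<^sup>2 = ((h \<omega> * Y t \<omega> - h \<omega> * Y s \<omega>) + (q t - q s) * h \<omega>) +
        2 * (h \<omega> * (Z s \<omega> * Z s \<omega>) - h \<omega> * (Z s \<omega> * Z t \<omega>))"
      using AE_V_eq_q
      by eventually_elim (use st t in \<open>simp add: Y_def power2_eq_square algebra_simps\<close>)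
  qed (use Yi[OF st(1)] Yi[OF t] in measurable)
  also have "\<dots> = ((\<integral>\<omega>. h \<omega> * Y t \<omega> \<partial>M) - (\<integral>\<omega>. h \<omega> * Y s \<omega> \<partial>M) + (q t - q s) * (\<integral>\<omega>. h \<omega> \<partial>M)) +
      2 * ((\<integral>\<omega>. h \<omega> * (Z s \<omega> * Z s \<omega>) \<partial>M) - (\<integral>\<omega>. h \<omega> * (Z s \<omega> * Z t \<omega>) \<partial>M))"
    using i2 i3 i4 by simp
  finally show "(\<integral>\<omega>. h \<omega> * (Z t \<omega> - Z s \<omega>)\<^sup>2 \<partial>M) = (q t - q s) * (\<integral>\<omega>. h \<omega> \<partial>M)"
    using m2 m3 by simp
qed

lemma integrable_bounded_mult_complex:
  fixes h :: "'a \<Rightarrow> complex" and f :: "'a \<Rightarrow> real"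
  assumes "integrable M f" "h \<in> borel_measurable M" "\<And>\<omega>. cmod (h \<omega>) \<le> 1"
  shows "integrable M (\<lambda>\<omega>. h \<omega> * f \<omega>)"
proof (rule Bochner_Integration.integrable_bound[OF assms(1)])
  show "AE \<omega> in M. norm (h \<omega> * f \<omega>) \<le> norm (f \<omega>)"
    using mult_right_mono[OF assms(3) abs_ge_zero] by (auto simp: norm_mult)
qed (use assms in measurable)

text \<open>Real and imaginary parts reduce this to the real case. Complex weights are needed
  because the weight will be the exponential accumulated up to time \<open>s\<close>.\<close>

lemma increment_moments:
  fixes h :: "'a \<Rightarrow> complex"
  assumes st: "0 \<le> s" "s \<le> t" and h: "h \<in> borel_measurable (F s)" "\<And>\<omega>. cmod (h \<omega>) \<le> 1"
  shows "(\<integral>\<omega>. h \<omega> * (Z t \<omega> - Z s \<omega>) \<partial>M) = 0"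
    and "(\<integral>\<omega>. h \<omega> * (Z t \<omega> - Z s \<omega>)\<^sup>2 \<partial>M) = (q t - q s) * (\<integral>\<omega>. h \<omega> \<partial>M)"
proof -
  have t: "0 \<le> t" using st by simp
  have hM[measurable]: "h \<in> borel_measurable M"
    using measurable_from_subalg[OF subalgebra_F[OF st(1)] h(1)] .
  have i0: "integrable M h"
    using h(2) by (intro integrable_const_bound[where B = 1]) auto
  have i1: "integrable M (\<lambda>\<omega>. h \<omega> * (Z t \<omega> - Z s \<omega>))"
    by (rule integrable_bounded_mult_complex[OF _ hM h(2)]) (use Z_integrable st t in auto)
  have i2: "integrable M (\<lambda>\<omega>. h \<omega> * complex_of_real ((Z t \<omega> - Z s \<omega>)\<^sup>2))"
    by (rule integrable_bounded_mult_complex[OF _ hM h(2)]) (use increment_square_integrable st t in auto)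
  have re: "(\<lambda>\<omega>. Re (h \<omega>)) \<in> borel_measurable (F s)" "\<bar>Re (h \<omega>)\<bar> \<le> 1" for \<omega>
    using h order_trans[OF abs_Re_le_cmod h(2)] by auto
  have im: "(\<lambda>\<omega>. Im (h \<omega>)) \<in> borel_measurable (F s)" "\<bar>Im (h \<omega>)\<bar> \<le> 1" for \<omega>
    using h order_trans[OF abs_Im_le_cmod h(2)] by auto
  note R = increment_moments_real[OF st re] and I = increment_moments_real[OF st im]
  have "Re (\<integral>\<omega>. h \<omega> * (Z t \<omega> - Z s \<omega>) \<partial>M) = 0" "Im (\<integral>\<omega>. h \<omega> * (Z t \<omega> - Z s \<omega>) \<partial>M) = 0"
    using R(1) I(1) by (simp_all add: integral_Re[OF i1, symmetric] integral_Im[OF i1, symmetric] del: of_real_diff)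
  then show "(\<integral>\<omega>. h \<omega> * (Z t \<omega> - Z s \<omega>) \<partial>M) = 0" by (simp add: complex_eq_iff)
  have "Re (\<integral>\<omega>. h \<omega> * complex_of_real ((Z t \<omega> - Z s \<omega>)\<^sup>2) \<partial>M) = (q t - q s) * Re (\<integral>\<omega>. h \<omega> \<partial>M)"
    "Im (\<integral>\<omega>. h \<omega> * complex_of_real ((Z t \<omega> - Z s \<omega>)\<^sup>2) \<partial>M) = (q t - q s) * Im (\<integral>\<omega>. h \<omega> \<partial>M)"
    using R(2) I(2) by (simp_all add: integral_Re[OF i2, symmetric] integral_Im[OF i2, symmetric]
        integral_Re[OF i0, symmetric] integral_Im[OF i0, symmetric] del: of_real_diff of_real_power)
  then show "(\<integral>\<omega>. h \<omega> * (Z t \<omega> - Z s \<omega>)\<^sup>2 \<partial>M) = (q t - q s) * (\<integral>\<omega>. h \<omega> \<partial>M)"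
    by (simp add: complex_eq_iff del: of_real_diff of_real_power)
qed

end

section \<open>Taylor comparison of the exponential along a grid\<close>

lemma norm_integral_le:
  fixes f :: "'a \<Rightarrow> 'b::{banach,second_countable_topology}"
  assumes "integrable M f" "integrable M g" "\<And>x. norm (f x) \<le> g x"
  shows "norm (\<integral>x. f x \<partial>M) \<le> (\<integral>x. g x \<partial>M)"
  using integral_norm_bound[of M f] integral_mono[OF integrable_norm[OF assms(1)] assms(2,3)]
  by (rule order_trans)

context nonrandom_qv
begin

text \<open>The exponential martingale is compared with 1 step by step along a grid. Taylor's formula up to
  second order leaves a remainder that is small as long as the increments stay below \<open>e\<close>; the
  factor \<open>ok\<close> switches the comparison off after the first larger increment, whose square is still
  dominated by \<open>4 * S\<close>.\<close>

lemma char_increment_error: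
  fixes e s t \<theta> :: real and k :: nat
  assumes st: "0 \<le> s" "s \<le> t" and k: "0 < k" and e: "0 < e" and A: "A \<in> sets (F s)"
    and S: "integrable M S" "AE \<omega> in M. \<forall>u\<in>{0..t}. (Z u \<omega>)\<^sup>2 \<le> S \<omega>"
  defines "\<tau> \<equiv> grid s t k"
  defines "ok \<equiv> \<lambda>j \<omega>. if \<forall>i<j. \<bar>Z (\<tau> (Suc i)) \<omega> - Z (\<tau> i) \<omega>\<bar> \<le> e then 1 else 0 :: real"
  defines "C \<equiv> exp (\<theta>\<^sup>2 / 2 * (q t - q s))"
  shows "cmod (C * (\<integral>\<omega>. indicator A \<omega> * iexp (\<theta> * (Z t \<omega> - Z s \<omega>)) \<partial>M) - measure M A)
    \<le> C * ((\<Sum>j<k. (\<theta>\<^sup>2 / 2 * (q (\<tau> (Suc j)) - q (\<tau> j)))\<^sup>2) + \<bar>\<theta>\<bar> ^ 3 * e * (q t - q s)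
      + 4 * \<theta>\<^sup>2 * (\<integral>\<omega>. S \<omega> * (1 - ok k \<omega>) \<partial>M) + 2 * (\<integral>\<omega>. 1 - ok k \<omega> \<partial>M))"
proof -
  have t: "0 \<le> t" using st by simp
  have \<tau>: "0 \<le> \<tau> i" "s \<le> \<tau> i" "\<tau> i \<le> \<tau> (Suc i)" for i
    unfolding \<tau>_def using st grid_ge[OF st(2), of k i] by (auto simp: grid_mono)
  have \<tau>_mono: "\<tau> i \<le> \<tau> j" if "i \<le> j" for i j
    unfolding \<tau>_def using st that by (simp add: grid_mono)
  have \<tau>_le: "\<tau> i \<le> t" if "i \<le> k" for i
    unfolding \<tau>_def using st that by (auto simp: grid_le)
  have \<tau>_ends: "\<tau> 0 = s" "\<tau> k = t" using k by (auto simp: \<tau>_def)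
  have ZF: "Z (\<tau> i) \<in> borel_measurable (F (\<tau> j))" if "i \<le> j" for i j
    using \<tau>(1) \<tau>_mono[OF that] Z_measurable_F[OF \<tau>(1)] by (rule borel_measurable_F_mono)
  have ZF_s: "Z s \<in> borel_measurable (F (\<tau> j))" for j
    using ZF[of 0 j] \<tau>_ends by simp
  have [measurable]: "Z (\<tau> i) \<in> borel_measurable M" "Z s \<in> borel_measurable M" "Z t \<in> borel_measurable M" for i
    using \<tau> st t by auto
  have AF: "A \<in> sets (F (\<tau> j))" for j
    using A F_mono[OF st(1) \<tau>(2)] by auto
  have AM[measurable]: "A \<in> sets M"
    using A subalgebra_F[OF st(1)] by (auto simp: subalgebra_def)
  have SM[measurable]: "S \<in> borel_measurable M" using S(1) by simp
  define D where "D j \<omega> = Z (\<tau> (Suc j)) \<omega> - Z (\<tau> j) \<omega>" for j \<omega>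
  have [measurable]: "D j \<in> borel_measurable M" for j unfolding D_def by measurable
  have D_sq: "integrable M (\<lambda>\<omega>. (D j \<omega>)\<^sup>2)" "integrable M (D j)" for j
    unfolding D_def using \<tau> by (auto intro: increment_square_integrable Z_integrable)
  \<comment> \<open>The exponent that a Gaussian increment with the variance of step
    \<open>j\<close> would contribute.\<close>
  define x where "x j = \<theta>\<^sup>2 / 2 * (q (\<tau> (Suc j)) - q (\<tau> j))" for j
  have x_nonneg: "0 \<le> x j" for j
    unfolding x_def using \<tau> by (intro mult_nonneg_nonneg) (auto intro: q_mono)
  \<comment> \<open>The compensator: for Gaussian increments with variances given by
    \<open>q\<close>, its product with the characteristic function of the increment up to
    \<open>\<tau> j\<close> would be constant.\<close>
  define c where "c j = exp (\<theta>\<^sup>2 / 2 * (q (\<tau> j) - q s))" for j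
  have c_le: "c j \<le> C" if "j \<le> k" for j
    unfolding c_def C_def using q_mono[OF \<tau>(1) \<tau>_le[OF that]] by (auto intro!: mult_left_mono)
  have c_Suc: "c (Suc j) = c j * exp (x j)" for j
    unfolding c_def x_def exp_add[symmetric] by (simp add: field_simps)
  have c_pos: "0 < c j" for j by (simp add: c_def)
  have C_pos: "0 < C" by (simp add: C_def)
  have ok_F: "ok j \<in> borel_measurable (F (\<tau> j))" for j
  proof -
    have [measurable]: "Z (\<tau> i) \<in> borel_measurable (F (\<tau> j))" if "i \<in> {..j}" for i
      using that by (intro ZF) auto
    have "Measurable.pred (F (\<tau> j)) (\<lambda>\<omega>. \<forall>i\<in>{..<j}. \<bar>Z (\<tau> (Suc i)) \<omega> - Z (\<tau> i) \<omega>\<bar> \<le> e)"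
      by (intro pred_intros_finite) auto
    then have [measurable]: "Measurable.pred (F (\<tau> j)) (\<lambda>\<omega>. \<forall>i<j. \<bar>Z (\<tau> (Suc i)) \<omega> - Z (\<tau> i) \<omega>\<bar> \<le> e)"
      by (simp add: Ball_def)
    show ?thesis unfolding ok_def by measurable
  qed
  then have [measurable]: "ok j \<in> borel_measurable M" for j
    using borel_measurable_F \<tau> by blast
  have ok_bounds: "0 \<le> ok j \<omega>" "ok j \<omega> \<le> 1" for j \<omega> by (auto simp: ok_def)
  have ok_Suc: "ok (Suc j) \<omega> = ok j \<omega> * (if \<bar>D j \<omega>\<bar> \<le> e then 1 else 0)" for j \<omega>
    by (auto simp: ok_def D_def less_Suc_eq)
  have ok_0: "ok 0 \<omega> = 1" for \<omega> by (simp add: ok_def)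
  have ok_int: "integrable M (ok j)" for j
    using ok_bounds by (intro integrable_const_bound[where B = 1]) auto
  have Sok_int: "integrable M (\<lambda>\<omega>. S \<omega> * ok j \<omega>)" for j
    using integrable_bounded_mult[OF S(1), of "ok j"] ok_bounds by (simp add: mult.commute)
  \<comment> \<open>\<open>ok j\<close> looks only at steps before \<open>j\<close>, so
    \<open>H j\<close> is known at time \<open>\<tau> j\<close>, and a path is dropped only after
    its first large increment has been made.\<close>
  define H where "H j \<omega> = complex_of_real (indicator A \<omega> * ok j \<omega>) * iexp (\<theta> * (Z (\<tau> j) \<omega> - Z s \<omega>))" for j \<omega>
  have H_F: "H j \<in> borel_measurable (F (\<tau> j))" for j
    unfolding H_def using AF[of j] ok_F[of j] ZF[of j j] ZF_s[of j] by measurable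
  have H_M[measurable]: "H j \<in> borel_measurable M" for j
    using measurable_from_subalg[OF subalgebra_F[OF \<tau>(1)] H_F] .
  have H_le_ok: "cmod (H j \<omega>) \<le> ok j \<omega>" for j \<omega>
    using ok_bounds[of j \<omega>] by (simp add: H_def norm_mult indicator_def)
  have H_le: "cmod (H j \<omega>) \<le> 1" for j \<omega>
    using order_trans[OF H_le_ok ok_bounds(2)] .
  have H_int: "integrable M (H j)" for j
    using H_le by (intro integrable_const_bound[where B = 1]) auto
  have HE_int: "integrable M (\<lambda>\<omega>. H j \<omega> * iexp (\<theta> * D j \<omega>))" for j
    using H_le by (intro integrable_const_bound[where B = 1]) (auto simp: norm_mult)
  have H_Suc: "H (Suc j) \<omega> = H j \<omega> * iexp (\<theta> * D j \<omega>) * (if \<bar>D j \<omega>\<bar> \<le> e then 1 else 0)" for j \<omega>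
    by (simp add: H_def ok_Suc D_def exp_add[symmetric] algebra_simps)
  \<comment> \<open>Dropping the paths whose first large increment occurs in step \<open>j\<close>
    costs at most their probability, and these probabilities telescope.\<close>
  have loss: "cmod ((\<integral>\<omega>. H j \<omega> * iexp (\<theta> * D j \<omega>) \<partial>M) - (\<integral>\<omega>. H (Suc j) \<omega> \<partial>M))
      \<le> (\<integral>\<omega>. ok j \<omega> \<partial>M) - (\<integral>\<omega>. ok (Suc j) \<omega> \<partial>M)" for j
  proof -
    have "cmod (\<integral>\<omega>. H j \<omega> * iexp (\<theta> * D j \<omega>) - H (Suc j) \<omega> \<partial>M) \<le> (\<integral>\<omega>. ok j \<omega> - ok (Suc j) \<omega> \<partial>M)"
      using H_le_ok[of j] ok_bounds
      by (intro norm_integral_le Bochner_Integration.integrable_diff HE_int H_int ok_int)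
        (auto simp: H_Suc ok_Suc norm_mult)
    then show ?thesis
      using HE_int H_int ok_int by simp
  qed
  have rem_int: "integrable M (\<lambda>\<omega>. H j \<omega> * iexp_rem (\<theta> * D j \<omega>))" for j
  proof (rule Bochner_Integration.integrable_bound)
    show "integrable M (\<lambda>\<omega>. \<theta>\<^sup>2 * (D j \<omega>)\<^sup>2)" using D_sq by simp
    show "AE \<omega> in M. norm (H j \<omega> * iexp_rem (\<theta> * D j \<omega>)) \<le> norm (\<theta>\<^sup>2 * (D j \<omega>)\<^sup>2)"
    proof (rule AE_I2)
      fix \<omega>
      have "norm (H j \<omega> * iexp_rem (\<theta> * D j \<omega>)) \<le> 1 * (\<theta> * D j \<omega>)\<^sup>2"
        unfolding norm_mult by (intro mult_mono H_le iexp_rem_le_square) auto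
      then show "norm (H j \<omega> * iexp_rem (\<theta> * D j \<omega>)) \<le> norm (\<theta>\<^sup>2 * (D j \<omega>)\<^sup>2)"
        by (simp add: power_mult_distrib)
    qed
  qed measurable
  \<comment> \<open>By \<open>increment_moments\<close> the first-order Taylor term vanishes and the
    second-order one becomes \<open>x j\<close> times the mean of \<open>H j\<close>.\<close>
  have main: "(\<integral>\<omega>. H j \<omega> * iexp (\<theta> * D j \<omega>) \<partial>M)
      = (1 - x j) * (\<integral>\<omega>. H j \<omega> \<partial>M) + (\<integral>\<omega>. H j \<omega> * iexp_rem (\<theta> * D j \<omega>) \<partial>M)" for j
  proof -
    note mom = increment_moments[OF \<tau>(1) \<tau>(3) H_F H_le, of j, folded D_def]
    have i1: "integrable M (\<lambda>\<omega>. H j \<omega> * D j \<omega>)"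
      by (rule integrable_bounded_mult_complex[OF D_sq(2) H_M H_le])
    have i2: "integrable M (\<lambda>\<omega>. H j \<omega> * complex_of_real ((D j \<omega>)\<^sup>2))"
      by (rule integrable_bounded_mult_complex[OF D_sq(1) H_M H_le])
    have "(\<integral>\<omega>. H j \<omega> * iexp (\<theta> * D j \<omega>) \<partial>M) =
      (\<integral>\<omega>. H j \<omega> + (\<i> * \<theta>) * (H j \<omega> * D j \<omega>) - complex_of_real (\<theta>\<^sup>2 / 2) * (H j \<omega> * complex_of_real ((D j \<omega>)\<^sup>2))
        + H j \<omega> * iexp_rem (\<theta> * D j \<omega>) \<partial>M)"
      by (intro Bochner_Integration.integral_cong refl)
        (simp add: iexp_rem_def power_mult_distrib algebra_simps)
    also have "\<dots> = (\<integral>\<omega>. H j \<omega> \<partial>M) + (\<i> * \<theta>) * (\<integral>\<omega>. H j \<omega> * D j \<omega> \<partial>M)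
        - complex_of_real (\<theta>\<^sup>2 / 2) * (\<integral>\<omega>. H j \<omega> * complex_of_real ((D j \<omega>)\<^sup>2) \<partial>M)
        + (\<integral>\<omega>. H j \<omega> * iexp_rem (\<theta> * D j \<omega>) \<partial>M)"
      using H_int i1 i2 rem_int by (simp del: of_real_power)
    also have "\<dots> = (1 - x j) * (\<integral>\<omega>. H j \<omega> \<partial>M) + (\<integral>\<omega>. H j \<omega> * iexp_rem (\<theta> * D j \<omega>) \<partial>M)"
      unfolding mom by (simp add: x_def field_simps)
    finally show ?thesis .
  qed
  have rem: "cmod (\<integral>\<omega>. H j \<omega> * iexp_rem (\<theta> * D j \<omega>) \<partial>M)
      \<le> \<bar>\<theta>\<bar> ^ 3 * e * (q (\<tau> (Suc j)) - q (\<tau> j)) +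
        4 * \<theta>\<^sup>2 * ((\<integral>\<omega>. S \<omega> * ok j \<omega> \<partial>M) - (\<integral>\<omega>. S \<omega> * ok (Suc j) \<omega> \<partial>M))" if j: "j < k" for j
  proof -
    have ED: "(\<integral>\<omega>. (D j \<omega>)\<^sup>2 \<partial>M) = q (\<tau> (Suc j)) - q (\<tau> j)"
      using increment_moments_real(2)[OF \<tau>(1) \<tau>(3), of "\<lambda>_. 1" j] by (simp add: D_def prob_space)
    have "cmod (\<integral>\<omega>. H j \<omega> * iexp_rem (\<theta> * D j \<omega>) \<partial>M) \<le> (\<integral>\<omega>. norm (H j \<omega> * iexp_rem (\<theta> * D j \<omega>)) \<partial>M)"
      by (rule integral_norm_bound)
    also have "\<dots> \<le> (\<integral>\<omega>. \<bar>\<theta>\<bar> ^ 3 * e * (D j \<omega>)\<^sup>2 + 4 * \<theta>\<^sup>2 * (S \<omega> * ok j \<omega> - S \<omega> * ok (Suc j) \<omega>) \<partial>M)"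
    proof (rule integral_mono_AE)
      show "AE \<omega> in M. norm (H j \<omega> * iexp_rem (\<theta> * D j \<omega>)) \<le>
          \<bar>\<theta>\<bar> ^ 3 * e * (D j \<omega>)\<^sup>2 + 4 * \<theta>\<^sup>2 * (S \<omega> * ok j \<omega> - S \<omega> * ok (Suc j) \<omega>)"
        using S(2)
      proof eventually_elim
        case (elim \<omega>)
        show ?case
        proof (cases "\<bar>D j \<omega>\<bar> \<le> e")
          case True
          have "norm (H j \<omega> * iexp_rem (\<theta> * D j \<omega>)) \<le> 1 * (\<bar>\<theta> * D j \<omega>\<bar> ^ 3 / 6)"
            unfolding norm_mult by (intro mult_mono H_le iexp_rem_le_cube) auto
          also have "\<dots> \<le> \<bar>\<theta> * D j \<omega>\<bar> ^ 3" by simp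
          also have "\<dots> = \<bar>\<theta>\<bar> ^ 3 * (\<bar>D j \<omega>\<bar> * (D j \<omega>)\<^sup>2)"
            unfolding abs_mult power_mult_distrib power2_abs[of "D j \<omega>", symmetric]
            by (simp only: power3_eq_cube power2_eq_square mult.assoc)
          also have "\<dots> \<le> \<bar>\<theta>\<bar> ^ 3 * (e * (D j \<omega>)\<^sup>2)"
            using True by (intro mult_left_mono mult_right_mono) auto
          finally show ?thesis using True by (simp add: ok_Suc mult.assoc)
        next
          case False
          \<comment> \<open>Here \<open>j < k\<close> matters: \<open>S\<close> dominates only up to
            time \<open>t\<close>, and later grid points may lie beyond it.\<close>
          have "\<tau> j \<in> {0..t}" "\<tau> (Suc j) \<in> {0..t}" using \<tau> \<tau>_le j by auto
          then have "(Z (\<tau> j) \<omega>)\<^sup>2 \<le> S \<omega>" "(Z (\<tau> (Suc j)) \<omega>)\<^sup>2 \<le> S \<omega>" using elim by auto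
          \<comment> \<open>The square of a difference is at most twice the sum of the two squares;
            this is the origin of the 4.\<close>
          moreover have "0 \<le> (Z (\<tau> (Suc j)) \<omega> + Z (\<tau> j) \<omega>)\<^sup>2" by simp
          ultimately have D4: "(D j \<omega>)\<^sup>2 \<le> 4 * S \<omega>"
            unfolding D_def power2_sum power2_diff by linarith
          have "norm (H j \<omega> * iexp_rem (\<theta> * D j \<omega>)) \<le> ok j \<omega> * (\<theta> * D j \<omega>)\<^sup>2"
            unfolding norm_mult by (intro mult_mono H_le_ok iexp_rem_le_square ok_bounds) auto
          also have "\<dots> = (ok j \<omega> * \<theta>\<^sup>2) * (D j \<omega>)\<^sup>2" by (simp add: power_mult_distrib)
          also have "\<dots> \<le> (ok j \<omega> * \<theta>\<^sup>2) * (4 * S \<omega>)"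
            using ok_bounds by (intro mult_left_mono D4) auto
          also have "\<dots> \<le> \<bar>\<theta>\<bar> ^ 3 * e * (D j \<omega>)\<^sup>2 + (ok j \<omega> * \<theta>\<^sup>2) * (4 * S \<omega>)"
            using e by simp
          finally show ?thesis using False by (simp add: ok_Suc algebra_simps)
        qed
      qed
    qed (use rem_int[of j] D_sq Sok_int in \<open>auto intro!: Bochner_Integration.integrable_add\<close>)
    also have "\<dots> = \<bar>\<theta>\<bar> ^ 3 * e * (\<integral>\<omega>. (D j \<omega>)\<^sup>2 \<partial>M) +
        4 * \<theta>\<^sup>2 * ((\<integral>\<omega>. S \<omega> * ok j \<omega> \<partial>M) - (\<integral>\<omega>. S \<omega> * ok (Suc j) \<omega> \<partial>M))"
      using D_sq Sok_int by simp
    finally show ?thesis unfolding ED .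
  qed
  define u where "u j = c j * (\<integral>\<omega>. H j \<omega> \<partial>M)" for j
  define bd where "bd j = (x j)\<^sup>2 + (\<bar>\<theta>\<bar> ^ 3 * e * (q (\<tau> (Suc j)) - q (\<tau> j)) +
        4 * \<theta>\<^sup>2 * ((\<integral>\<omega>. S \<omega> * ok j \<omega> \<partial>M) - (\<integral>\<omega>. S \<omega> * ok (Suc j) \<omega> \<partial>M)))
        + ((\<integral>\<omega>. ok j \<omega> \<partial>M) - (\<integral>\<omega>. ok (Suc j) \<omega> \<partial>M))" for j
  have step: "cmod (u (Suc j) - u j) \<le> C * bd j" if j: "j < k" for j
  proof -
    define I where "I = (\<integral>\<omega>. H j \<omega> \<partial>M)"
    define R where "R = (\<integral>\<omega>. H j \<omega> * iexp_rem (\<theta> * D j \<omega>) \<partial>M)"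
    define L where "L = (\<integral>\<omega>. H j \<omega> * iexp (\<theta> * D j \<omega>) \<partial>M) - (\<integral>\<omega>. H (Suc j) \<omega> \<partial>M)"
    have HS: "(\<integral>\<omega>. H (Suc j) \<omega> \<partial>M) = (1 - x j) * I + R - L"
      unfolding L_def main I_def R_def by simp
    \<comment> \<open>Both terms are referred to \<open>c (Suc j)\<close>, so that one step compares
      \<open>1 - x j\<close> with \<open>exp (- x j)\<close>.\<close>
    have cc: "c j = c (Suc j) * exp (- x j)"
      by (simp add: c_Suc mult.assoc exp_add[symmetric])
    have "u (Suc j) - u j = c (Suc j) * (complex_of_real (1 - x j - exp (- x j)) * I + R - L)"
      unfolding u_def HS I_def[symmetric] by (simp add: cc algebra_simps)
    also have "cmod \<dots> = c (Suc j) * cmod (complex_of_real (1 - x j - exp (- x j)) * I + R - L)"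
      using c_pos[of "Suc j"] by (simp add: norm_mult)
    also have "\<dots> \<le> C * bd j"
    proof (intro mult_mono c_le)
      have "cmod I \<le> (\<integral>\<omega>. 1 \<partial>M)"
        unfolding I_def using H_le H_int by (intro norm_integral_le) auto
      then have I1: "cmod I \<le> 1" by (simp add: prob_space)
      have "cmod (complex_of_real (1 - x j - exp (- x j)) * I + R - L)
          \<le> \<bar>1 - x j - exp (- x j)\<bar> * cmod I + cmod R + cmod L"
        by (metis (no_types) add_mono norm_of_real norm_mult norm_triangle_ineq norm_triangle_le_diff order_refl)
      also have "\<dots> \<le> (x j)\<^sup>2 * 1 + cmod R + cmod L"
        using exp_minus_quadratic_bound[OF x_nonneg] I1 by (intro add_mono mult_mono) auto
      also have "\<dots> \<le> bd j"
        using rem[OF j] loss[of j] unfolding bd_def R_def L_def by simp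
      finally show "cmod (complex_of_real (1 - x j - exp (- x j)) * I + R - L) \<le> bd j" .
    qed (use j C_pos in auto)
    finally show ?thesis .
  qed
  have "cmod (u k - u 0) \<le> (\<Sum>j<k. cmod (u (Suc j) - u j))"
    unfolding sum_lessThan_telescope[symmetric] by (rule norm_sum)
  also have "\<dots> \<le> (\<Sum>j<k. C * bd j)"
    using step by (intro sum_mono) auto
  also have "\<dots> = C * ((\<Sum>j<k. (x j)\<^sup>2) + \<bar>\<theta>\<bar> ^ 3 * e * (q t - q s) +
      4 * \<theta>\<^sup>2 * ((\<integral>\<omega>. S \<omega> * ok 0 \<omega> \<partial>M) - (\<integral>\<omega>. S \<omega> * ok k \<omega> \<partial>M))
      + ((\<integral>\<omega>. ok 0 \<omega> \<partial>M) - (\<integral>\<omega>. ok k \<omega> \<partial>M)))"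
  proof -
    \<comment> \<open>The step variances add up to \<open>q t - q s\<close>. As \<open>ok 0\<close>
      is 1, the other two sums become the contributions of all paths dropped by the end.\<close>
    have tel: "(\<Sum>j<k. q (\<tau> (Suc j)) - q (\<tau> j)) = q t - q s"
      "(\<Sum>j<k. (\<integral>\<omega>. S \<omega> * ok j \<omega> \<partial>M) - (\<integral>\<omega>. S \<omega> * ok (Suc j) \<omega> \<partial>M))
        = (\<integral>\<omega>. S \<omega> * ok 0 \<omega> \<partial>M) - (\<integral>\<omega>. S \<omega> * ok k \<omega> \<partial>M)"
      "(\<Sum>j<k. (\<integral>\<omega>. ok j \<omega> \<partial>M) - (\<integral>\<omega>. ok (Suc j) \<omega> \<partial>M)) = (\<integral>\<omega>. ok 0 \<omega> \<partial>M) - (\<integral>\<omega>. ok k \<omega> \<partial>M)"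
      using sum_lessThan_telescope[of "\<lambda>j. q (\<tau> j)" k]
        sum_lessThan_telescope'[of "\<lambda>j. \<integral>\<omega>. S \<omega> * ok j \<omega> \<partial>M" k]
        sum_lessThan_telescope'[of "\<lambda>j. \<integral>\<omega>. ok j \<omega> \<partial>M" k]
      by (simp_all add: \<tau>_ends)
    show ?thesis
      unfolding bd_def sum_distrib_left[symmetric] sum.distrib tel by (simp only: add.assoc)
  qed
  finally have u_diff: "cmod (u k - u 0) \<le> C * ((\<Sum>j<k. (x j)\<^sup>2) + \<bar>\<theta>\<bar> ^ 3 * e * (q t - q s) +
      4 * \<theta>\<^sup>2 * (\<integral>\<omega>. S \<omega> * (1 - ok k \<omega>) \<partial>M) + (\<integral>\<omega>. 1 - ok k \<omega> \<partial>M))"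
    using S(1) Sok_int[of k] ok_int[of k] by (simp add: ok_0 right_diff_distrib prob_space)
  have u0: "u 0 = measure M A"
  proof -
    have "(\<integral>\<omega>. H 0 \<omega> \<partial>M) = (\<integral>\<omega>. complex_of_real (indicator A \<omega>) \<partial>M)"
      by (intro Bochner_Integration.integral_cong) (auto simp: H_def ok_0 \<tau>_ends)
    also have "\<dots> = measure M A" by (subst integral_complex_of_real) simp
    finally show ?thesis by (simp add: u_def c_def \<tau>_ends)
  qed
  define G where "G \<omega> = indicator A \<omega> * iexp (\<theta> * (Z t \<omega> - Z s \<omega>))" for \<omega>
  have G_int: "integrable M G"
    unfolding G_def by (intro integrable_const_bound[where B = 1]) (auto simp: norm_mult indicator_def)
  \<comment> \<open>Reinstating the dropped paths costs their probability a second time, hence the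
    factor 2 in the statement.\<close>
  have "cmod ((\<integral>\<omega>. G \<omega> \<partial>M) - (\<integral>\<omega>. H k \<omega> \<partial>M)) \<le> (\<integral>\<omega>. 1 - ok k \<omega> \<partial>M)"
  proof -
    have "cmod (\<integral>\<omega>. G \<omega> - H k \<omega> \<partial>M) \<le> (\<integral>\<omega>. 1 - ok k \<omega> \<partial>M)"
    proof (rule norm_integral_le)
      show "integrable M (\<lambda>\<omega>. G \<omega> - H k \<omega>)" "integrable M (\<lambda>\<omega>. 1 - ok k \<omega>)"
        using G_int H_int ok_int by auto
      show "cmod (G \<omega> - H k \<omega>) \<le> 1 - ok k \<omega>" for \<omega>
        by (auto simp: G_def H_def \<tau>_ends ok_def indicator_def)
    qed
    then show ?thesis using G_int H_int by simp
  qed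
  moreover have "c k = C" by (simp add: c_def C_def \<tau>_ends)
  then have "C * (\<integral>\<omega>. G \<omega> \<partial>M) - u k = C * ((\<integral>\<omega>. G \<omega> \<partial>M) - (\<integral>\<omega>. H k \<omega> \<partial>M))"
    by (simp add: u_def algebra_simps)
  then have "cmod (C * (\<integral>\<omega>. G \<omega> \<partial>M) - u k) = C * cmod ((\<integral>\<omega>. G \<omega> \<partial>M) - (\<integral>\<omega>. H k \<omega> \<partial>M))"
    using C_pos by (simp add: norm_mult)
  ultimately have G_diff: "cmod (C * (\<integral>\<omega>. G \<omega> \<partial>M) - u k) \<le> C * (\<integral>\<omega>. 1 - ok k \<omega> \<partial>M)"
    using C_pos by simp
  have "cmod (C * (\<integral>\<omega>. G \<omega> \<partial>M) - u 0) \<le> cmod (C * (\<integral>\<omega>. G \<omega> \<partial>M) - u k) + cmod (u k - u 0)"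
    using norm_triangle_ineq[of "C * (\<integral>\<omega>. G \<omega> \<partial>M) - u k" "u k - u 0"] by simp
  also note add_mono[OF G_diff u_diff]
  finally show ?thesis
    unfolding G_def x_def u0 by (simp add: algebra_simps)
qed

text \<open>For fixed \<open>e\<close> the mesh tends to 0: almost every path is uniformly
  continuous on the interval, so the switch is eventually 1 and dominated convergence removes both
  terms containing it. Then \<open>e\<close> tends to 0. As \<open>A\<close> is any past event, this
  is a conditional characteristic function.\<close>

lemma char_increment:
  assumes st: "0 \<le> s" "s \<le> t" and A: "A \<in> sets (F s)"
  shows "(\<integral>\<omega>. indicator A \<omega> * iexp (\<theta> * (Z t \<omega> - Z s \<omega>)) \<partial>M)
    = complex_of_real (measure M A * exp (- (\<theta>\<^sup>2 / 2 * (q t - q s))))"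
proof -
  have t: "0 \<le> t" using st by simp
  define I where "I = (\<integral>\<omega>. indicator A \<omega> * iexp (\<theta> * (Z t \<omega> - Z s \<omega>)) \<partial>M)"
  define C where "C = exp (\<theta>\<^sup>2 / 2 * (q t - q s))"
  obtain S where S: "integrable M S" "AE \<omega> in M. \<forall>u\<in>{0..t}. (Z u \<omega>)\<^sup>2 \<le> S \<omega>"
    using dominating_square[OF t] .
  have SM[measurable]: "S \<in> borel_measurable M" using S(1) by simp
  have q_diff: "0 \<le> q t - q s" using q_mono[OF st] by simp
  \<comment> \<open>Collects what remains of order \<open>e\<close>: the first summand from the
    squared exponents of the steps, the second from the cubic Taylor bound.\<close>
  define K where "K = (\<theta>\<^sup>2 / 2)\<^sup>2 * (q t - q s) + \<bar>\<theta>\<bar> ^ 3 * (q t - q s)"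
  have le: "cmod (C * I - measure M A) \<le> C * (K * e)" if e: "0 < e" for e
  proof -
    define ok where "ok k \<omega> = (if \<forall>i<k. \<bar>Z (grid s t k (Suc i)) \<omega> - Z (grid s t k i) \<omega>\<bar> \<le> e then 1 else 0 :: real)" for k \<omega>
    have [measurable]: "ok k \<in> borel_measurable M" for k
    proof -
      have [measurable]: "Z (grid s t k i) \<in> borel_measurable M" for i
        using grid_ge[OF st(2), of k i] st by (intro Z_measurable) auto
      show ?thesis unfolding ok_def by measurable
    qed
    have ok_lim: "AE \<omega> in M. (\<lambda>k. ok k \<omega>) \<longlonglongrightarrow> 1"
      using Z_continuous[unfolded continuous_process_def]
    proof eventually_elim
      case (elim \<omega>)
      have "continuous_on {s..t} (\<lambda>t. Z t \<omega>)"
        using elim by (rule continuous_on_subset) (use st in auto)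
      from continuous_on_grid_steps[OF st(2) this e]
      have "eventually (\<lambda>k. ok k \<omega> = 1) sequentially"
        by eventually_elim (simp add: ok_def)
      then show ?case by (rule tendsto_eventually)
    qed
    have ok01: "\<bar>1 - ok k \<omega>\<bar> \<le> 1" for k \<omega> by (simp add: ok_def)
    have lim1: "(\<lambda>k. \<integral>\<omega>. 1 - ok k \<omega> \<partial>M) \<longlonglongrightarrow> (\<integral>\<omega>. 0 \<partial>M)"
    proof (rule integral_dominated_convergence[where w = "\<lambda>_. 1"])
      show "AE \<omega> in M. (\<lambda>k. 1 - ok k \<omega>) \<longlonglongrightarrow> 0"
        using ok_lim by eventually_elim (auto intro!: tendsto_eq_intros)
    qed (use ok01 in auto)
    have lim2: "(\<lambda>k. \<integral>\<omega>. S \<omega> * (1 - ok k \<omega>) \<partial>M) \<longlonglongrightarrow> (\<integral>\<omega>. 0 \<partial>M)"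
    proof (rule integral_dominated_convergence[where w = "\<lambda>\<omega>. \<bar>S \<omega>\<bar>"])
      show "AE \<omega> in M. (\<lambda>k. S \<omega> * (1 - ok k \<omega>)) \<longlonglongrightarrow> 0"
        using ok_lim by eventually_elim (auto intro!: tendsto_eq_intros)
      show "AE \<omega> in M. norm (S \<omega> * (1 - ok k \<omega>)) \<le> \<bar>S \<omega>\<bar>" for k
        using mult_left_mono[OF ok01 abs_ge_zero] by (auto simp: abs_mult)
    qed (use S(1) in auto)
    define g where "g k = C * (K * e + 4 * \<theta>\<^sup>2 * (\<integral>\<omega>. S \<omega> * (1 - ok k \<omega>) \<partial>M) + 2 * (\<integral>\<omega>. 1 - ok k \<omega> \<partial>M))" for k
    have "g \<longlonglongrightarrow> C * (K * e + 4 * \<theta>\<^sup>2 * 0 + 2 * 0)"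
      unfolding g_def using lim1 lim2 by (intro tendsto_intros) auto
    then have g: "g \<longlonglongrightarrow> C * (K * e)" by simp
    have "continuous_on {s..t} q"
      using q_continuous by (rule continuous_on_subset) (use st in auto)
    from continuous_on_grid_steps[OF st(2) this e]
    have "eventually (\<lambda>k. cmod (C * I - measure M A) \<le> g k) sequentially"
      using eventually_gt_at_top[of 0]
    proof eventually_elim
      case (elim k)
      let ?d = "\<lambda>j. q (grid s t k (Suc j)) - q (grid s t k j)"
      have d0: "0 \<le> ?d j" for j
        using grid_ge[OF st(2), of k j] st by (auto intro!: q_mono grid_mono)
      have "(\<Sum>j<k. (\<theta>\<^sup>2 / 2 * ?d j)\<^sup>2) \<le> (\<Sum>j<k. (\<theta>\<^sup>2 / 2)\<^sup>2 * (e * ?d j))"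
      proof (rule sum_mono)
        fix j assume "j \<in> {..<k}"
        then have "?d j \<le> e" using elim by (auto simp: abs_le_iff)
        then have "?d j * ?d j \<le> e * ?d j" using d0 by (intro mult_right_mono)
        then show "(\<theta>\<^sup>2 / 2 * ?d j)\<^sup>2 \<le> (\<theta>\<^sup>2 / 2)\<^sup>2 * (e * ?d j)"
          unfolding power_mult_distrib power2_eq_square[of "?d j"] by (intro mult_left_mono) auto
      qed
      also have "\<dots> = (\<theta>\<^sup>2 / 2)\<^sup>2 * (e * (q t - q s))"
        using elim sum_lessThan_telescope[of "\<lambda>j. q (grid s t k j)" k]
        by (simp add: sum_distrib_left[symmetric])
      finally have "(\<Sum>j<k. (\<theta>\<^sup>2 / 2 * ?d j)\<^sup>2) \<le> (\<theta>\<^sup>2 / 2)\<^sup>2 * (e * (q t - q s))" .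
      then have "(\<Sum>j<k. (\<theta>\<^sup>2 / 2 * ?d j)\<^sup>2) + \<bar>\<theta>\<bar> ^ 3 * e * (q t - q s) \<le> K * e"
        by (simp add: K_def algebra_simps)
      moreover note char_increment_error[OF st _ e A S, of k \<theta>, folded ok_def C_def I_def]
      moreover have "0 < C" by (simp add: C_def)
      ultimately show ?case
        using elim unfolding g_def
        by (meson add_right_mono less_imp_le mult_left_mono order_trans)
    qed
    then show ?thesis
      by (intro tendsto_lowerbound[OF g]) auto
  qed
  have "((\<lambda>e. C * (K * e)) \<longlongrightarrow> C * (K * 0)) (at_right 0)"
    by (intro tendsto_intros)
  then have "cmod (C * I - measure M A) \<le> C * (K * 0)"
    by (rule tendsto_lowerbound) (auto simp: eventually_at_right_less le intro!: eventually_mono[OF eventually_at_right_less])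
  then have "C * I = measure M A" by simp
  moreover have "complex_of_real (exp (- (\<theta>\<^sup>2 / 2 * (q t - q s)))) * C = 1"
    unfolding C_def of_real_mult[symmetric] exp_add[symmetric] by simp
  ultimately have "I = complex_of_real (exp (- (\<theta>\<^sup>2 / 2 * (q t - q s)))) * measure M A"
    by (metis mult.assoc mult.left_neutral)
  then show ?thesis unfolding I_def by simp
qed

end

section \<open>Laws of grid maxima and crossing events\<close>

lemma (in prob_space) char_distr:
  assumes "X \<in> borel_measurable M"
  shows "char (distr M borel X) \<theta> = (\<integral>\<omega>. iexp (\<theta> * X \<omega>) \<partial>M)"
  unfolding char_def using assms by (subst integral_distr) auto

lemma (in prob_space) char_wiener_increment:
  assumes W: "wiener_process M W" and st: "0 \<le> s" "s \<le> t"
  shows "char (distr M borel (\<lambda>\<omega>. W t \<omega> - W s \<omega>)) \<theta> = exp (- (\<theta>\<^sup>2 / 2 * (t - s)))"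
proof -
  have [measurable]: "W s \<in> borel_measurable M" "W t \<in> borel_measurable M"
    using W st by (auto simp: wiener_process_def)
  show ?thesis
  proof (cases "s = t")
    \<comment> \<open>The density in \<open>wiener_process\<close> covers only intervals of positive
      length; empty ones arise wherever \<open>q\<close> is constant.\<close>
    case True
    then show ?thesis by (subst char_distr) (auto simp: prob_space)
  next
    case False
    define \<sigma> where "\<sigma> = sqrt (t - s)"
    have \<sigma>: "0 < \<sigma>" "\<sigma>\<^sup>2 = t - s" using False st by (auto simp: \<sigma>_def)
    define N where "N \<omega> = (W t \<omega> - W s \<omega>) / \<sigma>" for \<omega>
    have [measurable]: "N \<in> borel_measurable M" unfolding N_def by measurable
    have "distributed M lborel (\<lambda>\<omega>. W t \<omega> - W s \<omega>) (normal_density 0 \<sigma>)"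
      using W st False unfolding wiener_process_def \<sigma>_def by auto
    then have "distributed M lborel N std_normal_density"
      using normal_standard_normal_convert[OF \<sigma>(1), of "\<lambda>\<omega>. W t \<omega> - W s \<omega>" 0] by (simp add: N_def[abs_def])
    then have "distr M lborel N = std_normal_distribution"
      by (rule distributed_distr_eq_density)
    then have N: "distr M borel N = std_normal_distribution"
      by (simp cong: distr_cong)
    have "char (distr M borel (\<lambda>\<omega>. W t \<omega> - W s \<omega>)) \<theta> = char (distr M borel N) (\<theta> * \<sigma>)"
      using \<sigma> by (subst (1 2) char_distr) (auto simp: N_def)
    also have "\<dots> = exp (- ((\<theta> * \<sigma>)\<^sup>2) / 2)"
      unfolding N char_std_normal_distribution ..
    also have "\<dots> = exp (- (\<theta>\<^sup>2 / 2 * (t - s)))"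
      using \<sigma> by (simp add: power_mult_distrib)
    finally show ?thesis .
  qed
qed

text \<open>Peeling off the last variable gives the product formula by induction. Products over the
  full index set suffice, because any factor may be taken to be the whole space.\<close>

lemma (in prob_space) indep_vars_if_indep_past:
  fixes D :: "nat \<Rightarrow> 'a \<Rightarrow> real"
  assumes D: "\<And>i. i < n \<Longrightarrow> D i \<in> borel_measurable M"
    and prod: "\<And>A m. (\<And>i. A i \<in> sets borel) \<Longrightarrow> m < n \<Longrightarrow>
      prob ({\<omega>\<in>space M. \<forall>j<m. D j \<omega> \<in> A j} \<inter> (D m -` A m \<inter> space M)) =
      prob {\<omega>\<in>space M. \<forall>j<m. D j \<omega> \<in> A j} * prob (D m -` A m \<inter> space M)"
  shows "indep_vars (\<lambda>_. borel) D {..<n}"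
proof (cases "n = 0")
  case True
  then show ?thesis by (simp add: indep_vars_def indep_sets_def)
next
  case False
  show ?thesis
  proof (subst indep_vars_finite[where E = "\<lambda>_. sets borel"])
    show "\<forall>A\<in>{..<n} \<rightarrow> sets borel. prob (\<Inter>j\<in>{..<n}. D j -` A j \<inter> space M) =
        (\<Prod>j\<in>{..<n}. prob (D j -` A j \<inter> space M))"
    proof
      fix A' assume A': "A' \<in> {..<n} \<rightarrow> sets (borel :: real measure)"
      \<comment> \<open>Extended by the empty set because \<open>prod\<close> asks for a Borel set
        at every index.\<close>
      define A where "A i = (if i < n then A' i else {})" for i
      have A: "A i \<in> sets borel" for i using A' by (auto simp: A_def)
      have "prob {\<omega>\<in>space M. \<forall>j<m. D j \<omega> \<in> A j} = (\<Prod>j<m. prob (D j -` A j \<inter> space M))"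
        if "m \<le> n" for m
        using that
      proof (induction m)
        case 0
        then show ?case by (simp add: prob_space)
      next
        case (Suc m)
        have "{\<omega>\<in>space M. \<forall>j<Suc m. D j \<omega> \<in> A j} =
            {\<omega>\<in>space M. \<forall>j<m. D j \<omega> \<in> A j} \<inter> (D m -` A m \<inter> space M)"
          by (auto simp: less_Suc_eq)
        then show ?case using Suc prod[of A m, OF A] by simp
      qed
      from this[of n]
      have "prob {\<omega>\<in>space M. \<forall>j<n. D j \<omega> \<in> A j} = (\<Prod>j<n. prob (D j -` A j \<inter> space M))" by simp
      also have "{\<omega>\<in>space M. \<forall>j<n. D j \<omega> \<in> A j} = (\<Inter>j\<in>{..<n}. D j -` A' j \<inter> space M)"
        using False by (auto simp: A_def)
      also have "(\<Prod>j<n. prob (D j -` A j \<inter> space M)) = (\<Prod>j<n. prob (D j -` A' j \<inter> space M))"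
        by (intro prod.cong) (auto simp: A_def)
      finally show "prob (\<Inter>j\<in>{..<n}. D j -` A' j \<inter> space M) =
        (\<Prod>j\<in>{..<n}. prob (D j -` A' j \<inter> space M))" .
    qed
    show "sets borel = sigma_sets (space borel) (sets borel)" for i :: nat
      by (rule sets.sigma_sets_eq[symmetric])
  qed (use False D in \<open>auto intro: sets.Int_stable\<close>)
qed

text \<open>The joint law of independent increments is a product measure, hence determined by its
  marginals. The grid maximum is a fixed measurable function of the increments, whose partial sums
  recover the values from the zero start.\<close>

lemma (in prob_space) grid_max_distr_eq:
  fixes X Y :: "real \<Rightarrow> 'a \<Rightarrow> real"
  assumes n: "0 < n"
    and meas: "\<And>i. X (\<tau> i) \<in> borel_measurable M" "\<And>i. Y (\<tau> i) \<in> borel_measurable M"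
    and zero: "AE \<omega> in M. X (\<tau> 0) \<omega> = 0" "AE \<omega> in M. Y (\<tau> 0) \<omega> = 0"
    and indep: "indep_vars (\<lambda>_. borel) (\<lambda>i \<omega>. X (\<tau> (Suc i)) \<omega> - X (\<tau> i) \<omega>) {..<n}"
      "indep_vars (\<lambda>_. borel) (\<lambda>i \<omega>. Y (\<tau> (Suc i)) \<omega> - Y (\<tau> i) \<omega>) {..<n}"
    and eq: "\<And>i. distr M borel (\<lambda>\<omega>. X (\<tau> (Suc i)) \<omega> - X (\<tau> i) \<omega>) =
      distr M borel (\<lambda>\<omega>. Y (\<tau> (Suc i)) \<omega> - Y (\<tau> i) \<omega>)"
  shows "distr M borel (\<lambda>\<omega>. Max ((\<lambda>i. X (\<tau> i) \<omega>) ` {..n})) =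
    distr M borel (\<lambda>\<omega>. Max ((\<lambda>i. Y (\<tau> i) \<omega>) ` {..n}))"
proof -
  define G where "G d = Max ((\<lambda>i. \<Sum>j<i. d j) ` {..n})" for d :: "nat \<Rightarrow> real"
  let ?P = "\<Pi>\<^sub>M i\<in>{..<n}. (borel :: real measure)"
  have G: "G \<in> borel_measurable ?P"
    unfolding G_def by (intro borel_measurable_Max borel_measurable_sum measurable_component_singleton) auto
  have rep: "distr M borel (\<lambda>\<omega>. Max ((\<lambda>i. U (\<tau> i) \<omega>) ` {..n})) =
      distr (distr M ?P (\<lambda>\<omega>. \<lambda>i\<in>{..<n}. U (\<tau> (Suc i)) \<omega> - U (\<tau> i) \<omega>)) borel G"
    if U: "\<And>i. U (\<tau> i) \<in> borel_measurable M" and zero: "AE \<omega> in M. U (\<tau> 0) \<omega> = 0" for U :: "real \<Rightarrow> 'a \<Rightarrow> real"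
  proof -
    note [measurable] = U
    have R: "(\<lambda>\<omega>. \<lambda>i\<in>{..<n}. U (\<tau> (Suc i)) \<omega> - U (\<tau> i) \<omega>) \<in> measurable M ?P"
      by (intro measurable_restrict) measurable
    show ?thesis
    proof (subst distr_distr[OF G R], rule distr_cong_AE)
      show "AE \<omega> in M. Max ((\<lambda>i. U (\<tau> i) \<omega>) ` {..n}) = (G \<circ> (\<lambda>\<omega>. \<lambda>i\<in>{..<n}. U (\<tau> (Suc i)) \<omega> - U (\<tau> i) \<omega>)) \<omega>"
        using zero
      proof eventually_elim
        case (elim \<omega>)
        have "(\<Sum>j<i. (\<lambda>i\<in>{..<n}. U (\<tau> (Suc i)) \<omega> - U (\<tau> i) \<omega>) j) = U (\<tau> i) \<omega>" if "i \<le> n" for i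
        proof -
          have "(\<Sum>j<i. (\<lambda>i\<in>{..<n}. U (\<tau> (Suc i)) \<omega> - U (\<tau> i) \<omega>) j) = (\<Sum>j<i. U (\<tau> (Suc j)) \<omega> - U (\<tau> j) \<omega>)"
            using that by (intro sum.cong) auto
          also have "\<dots> = U (\<tau> i) \<omega>"
            using sum_lessThan_telescope[of "\<lambda>j. U (\<tau> j) \<omega>" i] elim by simp
          finally show ?thesis .
        qed
        then have "(\<lambda>i. U (\<tau> i) \<omega>) ` {..n} =
            (\<lambda>i. \<Sum>j<i. (\<lambda>i\<in>{..<n}. U (\<tau> (Suc i)) \<omega> - U (\<tau> i) \<omega>) j) ` {..n}"
          by (intro image_cong) auto
        then show ?case unfolding G_def comp_def by simp
      qed
    qed (use measurable_comp[OF R G] in \<open>auto intro!: borel_measurable_Max U\<close>)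
  qed
  have ne: "{..<n} \<noteq> {}" using n by auto
  have "distr M ?P (\<lambda>\<omega>. \<lambda>i\<in>{..<n}. X (\<tau> (Suc i)) \<omega> - X (\<tau> i) \<omega>) =
      distr M ?P (\<lambda>\<omega>. \<lambda>i\<in>{..<n}. Y (\<tau> (Suc i)) \<omega> - Y (\<tau> i) \<omega>)"
    using indep
    by (simp add: indep_vars_iff_distr_eq_PiM[OF ne] borel_measurable_diff meas eq)
  then show ?thesis using rep[of X] rep[of Y] meas zero by simp
qed

text \<open>The grid maximum is squeezed between the values at grid points approaching a maximiser
  and the maximum itself.\<close>

lemma grid_max_tendsto:
  fixes f :: "real \<Rightarrow> real"
  assumes t: "0 \<le> t" and f: "continuous_on {0..t} f"
  obtains u where "u \<in> {0..t}" "\<And>v. v \<in> {0..t} \<Longrightarrow> f v \<le> f u"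
    "(\<lambda>n. Max ((\<lambda>i. f (grid 0 t n i)) ` {..n})) \<longlonglongrightarrow> f u"
proof -
  obtain u where u: "u \<in> {0..t}" "\<And>v. v \<in> {0..t} \<Longrightarrow> f v \<le> f u"
    using continuous_attains_sup[of "{0..t}" f] t f by auto
  then obtain r where r: "\<And>k. r k \<le> k" "(\<lambda>k. grid 0 t k (r k)) \<longlonglongrightarrow> u"
    using exists_grid_seq[of 0 u t] by auto
  have grid: "grid 0 t k i \<in> {0..t}" if "i \<le> k" for i k
    using t that by (auto simp: grid_ge grid_le)
  have "(\<lambda>n. Max ((\<lambda>i. f (grid 0 t n i)) ` {..n})) \<longlonglongrightarrow> f u"
  proof (rule real_tendsto_sandwich[where f = "\<lambda>k. f (grid 0 t k (r k))" and h = "\<lambda>_. f u"])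
    show "(\<lambda>k. f (grid 0 t k (r k))) \<longlonglongrightarrow> f u"
      using grid r(1) by (intro continuous_on_tendsto_compose[OF f r(2) u(1)]) auto
    show "\<forall>\<^sub>F k in sequentially. f (grid 0 t k (r k)) \<le> Max ((\<lambda>i. f (grid 0 t k i)) ` {..k})"
      using r(1) by (intro always_eventually allI Max_ge) auto
    show "\<forall>\<^sub>F k in sequentially. Max ((\<lambda>i. f (grid 0 t k i)) ` {..k}) \<le> f u"
      using grid u(2) by (intro always_eventually allI Max.boundedI) auto
  qed auto
  with u show thesis by (rule that)
qed

text \<open>Only the events, not the suprema, occur here, since the supremum of a discontinuous path has a
  junk value; the suprema enter the proof as limits of grid maxima.\<close>

lemma (in prob_space) crossing_event_prob_eq:
  fixes X Y :: "real \<Rightarrow> 'a \<Rightarrow> real"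
  assumes t: "0 \<le> t"
    and meas: "\<And>u. 0 \<le> u \<Longrightarrow> X u \<in> borel_measurable M" "\<And>u. 0 \<le> u \<Longrightarrow> Y u \<in> borel_measurable M"
    and cont: "AE \<omega> in M. continuous_on {0..t} (\<lambda>u. X u \<omega>)" "AE \<omega> in M. continuous_on {0..t} (\<lambda>u. Y u \<omega>)"
    and eq: "\<And>n. 0 < n \<Longrightarrow> distr M borel (\<lambda>\<omega>. Max ((\<lambda>i. X (grid 0 t n i) \<omega>) ` {..n})) =
      distr M borel (\<lambda>\<omega>. Max ((\<lambda>i. Y (grid 0 t n i) \<omega>) ` {..n}))"
  obtains A B where "A \<in> events" "B \<in> events" "prob A = prob B"
    "AE \<omega> in M. \<omega> \<in> A \<longleftrightarrow> (\<exists>u\<in>{0..t}. g \<le> X u \<omega>)" "AE \<omega> in M. \<omega> \<in> B \<longleftrightarrow> (\<exists>u\<in>{0..t}. g \<le> Y u \<omega>)"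
proof -
  define m where "m U n \<omega> = Max ((\<lambda>i. U (grid 0 t n i) \<omega>) ` {..n})" for U :: "real \<Rightarrow> 'a \<Rightarrow> real" and n \<omega>
  define L where "L U \<omega> = lim (\<lambda>n. m U n \<omega>)" for U :: "real \<Rightarrow> 'a \<Rightarrow> real" and \<omega>
  have m_meas: "m U n \<in> borel_measurable M" if "\<And>u. 0 \<le> u \<Longrightarrow> U u \<in> borel_measurable M" for U n
    unfolding m_def using t by (intro borel_measurable_Max that) (auto simp: grid_ge)
  have L_meas: "L U \<in> borel_measurable M" if "\<And>u. 0 \<le> u \<Longrightarrow> U u \<in> borel_measurable M" for U
    unfolding L_def by (intro borel_measurable_lim_metric m_meas that)
  have L: "AE \<omega> in M. (\<lambda>n. m U n \<omega>) \<longlonglongrightarrow> L U \<omega> \<and> (g \<le> L U \<omega> \<longleftrightarrow> (\<exists>u\<in>{0..t}. g \<le> U u \<omega>))"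
    if "AE \<omega> in M. continuous_on {0..t} (\<lambda>u. U u \<omega>)" for U
    using that
  proof eventually_elim
    case (elim \<omega>)
    obtain u where u: "u \<in> {0..t}" "\<And>v. v \<in> {0..t} \<Longrightarrow> U v \<omega> \<le> U u \<omega>"
      "(\<lambda>n. Max ((\<lambda>i. U (grid 0 t n i) \<omega>) ` {..n})) \<longlonglongrightarrow> U u \<omega>"
      by (rule grid_max_tendsto[OF t elim]) blast
    from u(3) have lim: "(\<lambda>n. m U n \<omega>) \<longlonglongrightarrow> U u \<omega>" by (simp add: m_def)
    have "L U \<omega> = U u \<omega>" unfolding L_def using lim by (rule limI)
    with lim u(1,2) show ?case by (auto intro: order_trans)
  qed
  \<comment> \<open>Almost sure convergence of the maxima carries over to characteristic functions,
    so uniqueness can identify the laws of the limits.\<close>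
  have lim: "(\<lambda>n. \<integral>\<omega>. iexp (\<theta> * m U n \<omega>) \<partial>M) \<longlonglongrightarrow> (\<integral>\<omega>. iexp (\<theta> * L U \<omega>) \<partial>M)"
    if "\<And>u. 0 \<le> u \<Longrightarrow> U u \<in> borel_measurable M" "AE \<omega> in M. continuous_on {0..t} (\<lambda>u. U u \<omega>)" for U \<theta>
  proof (rule integral_dominated_convergence[where w = "\<lambda>_. 1"])
    note [measurable] = m_meas[OF that(1)] L_meas[OF that(1)]
    show "(\<lambda>\<omega>. iexp (\<theta> * L U \<omega>)) \<in> borel_measurable M" "(\<lambda>\<omega>. iexp (\<theta> * m U n \<omega>)) \<in> borel_measurable M" for n
      by measurable
    show "AE \<omega> in M. (\<lambda>n. iexp (\<theta> * m U n \<omega>)) \<longlonglongrightarrow> iexp (\<theta> * L U \<omega>)"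
      using L[OF that(2)] by eventually_elim (auto intro!: tendsto_intros)
  qed auto
  have "distr M borel (L X) = distr M borel (L Y)"
  proof (rule Levy_uniqueness)
    show "char (distr M borel (L X)) = char (distr M borel (L Y))"
    proof
      fix \<theta>
      have "eventually (\<lambda>n. (\<integral>\<omega>. iexp (\<theta> * m X n \<omega>) \<partial>M) = (\<integral>\<omega>. iexp (\<theta> * m Y n \<omega>) \<partial>M)) sequentially"
        using eventually_gt_at_top[of 0]
      proof eventually_elim
        case (elim n)
        then show ?case
          using eq[of n] unfolding m_def[symmetric]
          by (simp only: char_distr[OF m_meas[OF meas(1)], symmetric] char_distr[OF m_meas[OF meas(2)], symmetric])
      qed
      with lim[OF meas(1) cont(1)]
      have "(\<lambda>n. \<integral>\<omega>. iexp (\<theta> * m Y n \<omega>) \<partial>M) \<longlonglongrightarrow> (\<integral>\<omega>. iexp (\<theta> * L X \<omega>) \<partial>M)"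
        by (rule Lim_transform_eventually)
      with lim[OF meas(2) cont(2)] have "(\<integral>\<omega>. iexp (\<theta> * L X \<omega>) \<partial>M) = (\<integral>\<omega>. iexp (\<theta> * L Y \<omega>) \<partial>M)"
        using LIMSEQ_unique by blast
      then show "char (distr M borel (L X)) \<theta> = char (distr M borel (L Y)) \<theta>"
        by (simp only: char_distr[OF L_meas[OF meas(1)]] char_distr[OF L_meas[OF meas(2)]])
    qed
  qed (intro real_distribution_distr L_meas meas; assumption)+
  \<comment> \<open>The closed half-line fits because the maximum is attained: it is at least
    \<open>g\<close> exactly when the path is at or above \<open>g\<close> somewhere.\<close>
  then have "measure (distr M borel (L X)) {g..} = measure (distr M borel (L Y)) {g..}" by simp
  then have p: "prob (L X -` {g..} \<inter> space M) = prob (L Y -` {g..} \<inter> space M)"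
    using L_meas[OF meas(1)] L_meas[OF meas(2)] by (simp add: measure_distr)
  show thesis
  proof (rule that[OF _ _ p])
    show "L X -` {g..} \<inter> space M \<in> events" "L Y -` {g..} \<inter> space M \<in> events"
      using measurable_sets[OF L_meas[OF meas(1)]] measurable_sets[OF L_meas[OF meas(2)]] by auto
    show "AE \<omega> in M. \<omega> \<in> L X -` {g..} \<inter> space M \<longleftrightarrow> (\<exists>u\<in>{0..t}. g \<le> X u \<omega>)"
      using L[OF cont(1)] AE_space by eventually_elim auto
    show "AE \<omega> in M. \<omega> \<in> L Y -` {g..} \<inter> space M \<longleftrightarrow> (\<exists>u\<in>{0..t}. g \<le> Y u \<omega>)"
      using L[OF cont(2)] AE_space by eventually_elim auto
  qed
qed

text \<open>If no value up to \<open>t\<close> reaches \<open>g\<close>, then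
  \<open>X t < g\<close>, and continuity leaves an interval after \<open>t\<close> free of
  crossings; the infimum is then strictly beyond \<open>t\<close>.\<close>

lemma first_passage_time_le_iff:
  assumes cont: "continuous_on {0..} (\<lambda>u. X u \<omega>)" and t: "0 \<le> t"
  shows "first_passage_time X g \<omega> \<le> ennreal t \<longleftrightarrow> (\<exists>u\<in>{0..t}. g \<le> X u \<omega>)"
proof
  assume "\<exists>u\<in>{0..t}. g \<le> X u \<omega>"
  then obtain u where u: "u \<in> {0..t}" "g \<le> X u \<omega>" by blast
  then have "first_passage_time X g \<omega> \<le> ennreal u"
    unfolding first_passage_time_def by (intro Inf_lower) auto
  also have "\<dots> \<le> ennreal t" using u by (intro ennreal_leI) auto
  finally show "first_passage_time X g \<omega> \<le> ennreal t" .
next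
  assume le: "first_passage_time X g \<omega> \<le> ennreal t"
  show "\<exists>u\<in>{0..t}. g \<le> X u \<omega>"
  proof (rule ccontr)
    assume no: "\<not> (\<exists>u\<in>{0..t}. g \<le> X u \<omega>)"
    then have "\<not> g \<le> X t \<omega>" using t atLeastAtMost_iff by blast
    then have "0 < g - X t \<omega>" by simp
    then obtain d where d: "0 < d" "\<And>u. 0 \<le> u \<Longrightarrow> dist u t < d \<Longrightarrow> dist (X u \<omega>) (X t \<omega>) < g - X t \<omega>"
      using cont t unfolding continuous_on_iff by (metis atLeast_iff)
    have "ennreal (t + d) \<le> first_passage_time X g \<omega>"
      unfolding first_passage_time_def
    proof (rule Inf_greatest)
      fix a assume "a \<in> {ennreal t |t. 0 \<le> t \<and> g \<le> X t \<omega>}"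
      then obtain v where v: "a = ennreal v" "0 \<le> v" "g \<le> X v \<omega>" by blast
      have "t + d \<le> v"
      proof (rule ccontr)
        assume "\<not> t + d \<le> v"
        moreover have "t < v" using no v by force
        ultimately have "dist (X v \<omega>) (X t \<omega>) < g - X t \<omega>"
          using v by (intro d(2)) (auto simp: dist_real_def)
        then show False using v(3) by (auto simp: dist_real_def abs_less_iff)
      qed
      then show "ennreal (t + d) \<le> a" unfolding v by (rule ennreal_leI)
    qed
    also note le
    finally show False using t d(1) by simp
  qed
qed

text \<open>The passage event need not be visibly measurable; completeness of \<open>M\<close> makes
  it so, since it differs from \<open>A\<close> by a null set.\<close>

lemma (in complete_stochastic_basis) crossing_prob_eq:
  assumes "continuous_process M X" "0 \<le> t" "A \<in> events"
    and A: "AE \<omega> in M. \<omega> \<in> A \<longleftrightarrow> (\<exists>u\<in>{0..t}. g \<le> X u \<omega>)"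
  shows "crossing_prob M X g t = prob A"
proof -
  have ae: "AE \<omega> in M. \<omega> \<in> A \<longleftrightarrow> \<omega> \<in> {\<omega> \<in> space M. first_passage_time X g \<omega> \<le> ennreal t}"
    using A AE_space assms(1)[unfolded continuous_process_def]
    by eventually_elim (simp add: first_passage_time_le_iff[OF _ assms(2)])
  have "{\<omega> \<in> space M. first_passage_time X g \<omega> \<le> ennreal t} \<in> events"
    using ae assms(3) by (rule in_sets_AE) auto
  then show ?thesis
    unfolding crossing_prob_def using finite_measure_eq_AE[OF ae assms(3)] by simp
qed

section \<open>The law of \<open>Z\<close> and the time change\<close>

context nonrandom_qv
begin

lemma char_Z_increment:
  assumes st: "0 \<le> s" "s \<le> t"
  shows "char (distr M borel (\<lambda>\<omega>. Z t \<omega> - Z s \<omega>)) \<theta> = exp (- (\<theta>\<^sup>2 / 2 * (q t - q s)))"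
proof -
  have [measurable]: "Z s \<in> borel_measurable M" "Z t \<in> borel_measurable M" using st by auto
  have "space M = space (F s)" using subalgebra_F[OF st(1)] by (simp add: subalgebra_def)
  then have sp: "space M \<in> sets (F s)" by simp
  have "char (distr M borel (\<lambda>\<omega>. Z t \<omega> - Z s \<omega>)) \<theta> = (\<integral>\<omega>. iexp (\<theta> * (Z t \<omega> - Z s \<omega>)) \<partial>M)"
    by (rule char_distr) measurable
  also have "\<dots> = (\<integral>\<omega>. indicator (space M) \<omega> * iexp (\<theta> * (Z t \<omega> - Z s \<omega>)) \<partial>M)"
    by (intro Bochner_Integration.integral_cong) auto
  also have "\<dots> = exp (- (\<theta>\<^sup>2 / 2 * (q t - q s)))"
    unfolding char_increment[OF st sp] by (simp add: prob_space)
  finally show ?thesis .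
qed

text \<open>Conditioning on \<open>A\<close> leaves the characteristic function of the increment
  unchanged, because \<open>char_increment\<close> gives the same factor for every \<open>A\<close>;
  uniqueness turns this into equality of laws. Null events admit no conditional measure and are
  treated apart.\<close>

lemma increment_indep_past:
  assumes st: "0 \<le> s" "s \<le> t" and A: "A \<in> sets (F s)" and B: "B \<in> sets borel"
  shows "prob (A \<inter> ((\<lambda>\<omega>. Z t \<omega> - Z s \<omega>) -` B \<inter> space M)) =
    prob A * prob ((\<lambda>\<omega>. Z t \<omega> - Z s \<omega>) -` B \<inter> space M)"
proof (cases "prob A = 0")
  case True
  have AM: "A \<in> events" using A subalgebra_F[OF st(1)] by (auto simp: subalgebra_def)
  have "prob (A \<inter> ((\<lambda>\<omega>. Z t \<omega> - Z s \<omega>) -` B \<inter> space M)) \<le> prob A"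
    by (intro finite_measure_mono AM) auto
  then show ?thesis using True by (simp add: measure_le_0_iff)
next
  case False
  define D where "D \<omega> = Z t \<omega> - Z s \<omega>" for \<omega>
  have D[measurable]: "D \<in> borel_measurable M"
    unfolding D_def using st by (intro borel_measurable_diff Z_measurable) auto
  have AM[measurable]: "A \<in> events" using A subalgebra_F[OF st(1)] by (auto simp: subalgebra_def)
  define N where "N = uniform_measure M A"
  have eA: "emeasure M A \<noteq> 0" using False by (simp add: emeasure_eq_measure)
  interpret N: prob_space N
    unfolding N_def using eA by (intro prob_space_uniform_measure) auto
  have DN[measurable]: "D \<in> borel_measurable N" unfolding N_def by simp
  have N: "N = density M (\<lambda>\<omega>. ennreal (indicator A \<omega> / prob A))"
    unfolding N_def uniform_measure_def
  proof (rule density_cong)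
    show "AE x in M. indicator A x / emeasure M A = ennreal (indicator A x / prob A)"
      using False by (intro AE_I2) (auto simp: emeasure_eq_measure indicator_def divide_ennreal zero_less_measure_iff
          simp flip: ennreal_1)
  qed auto
  have "distr N borel D = distr M borel D"
  proof (rule Levy_uniqueness)
    show "char (distr N borel D) = char (distr M borel D)"
    proof
      fix \<theta>
      have "char (distr N borel D) \<theta> = (\<integral>\<omega>. iexp (\<theta> * D \<omega>) \<partial>N)"
        by (rule N.char_distr) measurable
      also have "\<dots> = (\<integral>\<omega>. (indicator A \<omega> / prob A) *\<^sub>R iexp (\<theta> * D \<omega>) \<partial>M)"
        unfolding N by (rule integral_density) auto
      also have "\<dots> = (\<integral>\<omega>. complex_of_real (1 / prob A) * (indicator A \<omega> * iexp (\<theta> * D \<omega>)) \<partial>M)"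
        by (intro Bochner_Integration.integral_cong) (auto simp: indicator_def scaleR_conv_of_real)
      also have "\<dots> = complex_of_real (1 / prob A) * (\<integral>\<omega>. indicator A \<omega> * iexp (\<theta> * D \<omega>) \<partial>M)"
        by (rule integral_mult_right_zero)
      also have "\<dots> = char (distr M borel D) \<theta>"
        unfolding D_def char_increment[OF st A] char_Z_increment[OF st] using False by simp
      finally show "char (distr N borel D) \<theta> = char (distr M borel D) \<theta>" .
    qed
    show "real_distribution (distr N borel D)" by (rule N.real_distribution_distr) measurable
    show "real_distribution (distr M borel D)" by (rule real_distribution_distr) measurable
  qed
  then have "measure (distr N borel D) B = measure (distr M borel D) B" by simp
  then have "measure N (D -` B \<inter> space M) = prob (D -` B \<inter> space M)"
    using B by (simp add: measure_distr N_def)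
  moreover have "measure N (D -` B \<inter> space M) = prob (A \<inter> (D -` B \<inter> space M)) / prob A"
    unfolding N_def using eA measurable_sets[OF D B] by (intro measure_uniform_measure) auto
  ultimately show ?thesis
    using False unfolding D_def by (simp add: field_simps)
qed

text \<open>All earlier increments are known at time \<open>u m\<close>, so any joint event of them
  is a past event for the next increment.\<close>

lemma Z_increments_indep:
  assumes u: "\<And>i. 0 \<le> u i" "\<And>i j. i \<le> j \<Longrightarrow> u i \<le> u j"
  shows "indep_vars (\<lambda>_. borel) (\<lambda>i \<omega>. Z (u (Suc i)) \<omega> - Z (u i) \<omega>) {..<n}"
proof (rule indep_vars_if_indep_past)
  show "(\<lambda>\<omega>. Z (u (Suc i)) \<omega> - Z (u i) \<omega>) \<in> borel_measurable M" for i
    using u by measurable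
  fix A :: "nat \<Rightarrow> real set" and m :: nat assume A: "\<And>i. A i \<in> sets borel"
  have sp: "space M = space (F (u m))" using subalgebra_F[OF u(1)] by (simp add: subalgebra_def)
  have "{\<omega>\<in>space (F (u m)). \<forall>j\<in>{..<m}. Z (u (Suc j)) \<omega> - Z (u j) \<omega> \<in> A j} \<in> sets (F (u m))"
  proof (rule sets.sets_Collect_finite_All)
    fix j assume j: "j \<in> {..<m}"
    have [measurable]: "Z (u (Suc j)) \<in> borel_measurable (F (u m))" "Z (u j) \<in> borel_measurable (F (u m))"
      using j u by (auto intro!: borel_measurable_F_mono[OF _ _ Z_measurable_F])
    show "{\<omega>\<in>space (F (u m)). Z (u (Suc j)) \<omega> - Z (u j) \<omega> \<in> A j} \<in> sets (F (u m))"
      using A[of j] by measurable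
  qed auto
  then have "{\<omega>\<in>space M. \<forall>j<m. Z (u (Suc j)) \<omega> - Z (u j) \<omega> \<in> A j} \<in> sets (F (u m))"
    unfolding sp[symmetric] Ball_def lessThan_iff .
  then show "prob ({\<omega>\<in>space M. \<forall>j<m. Z (u (Suc j)) \<omega> - Z (u j) \<omega> \<in> A j} \<inter>
        ((\<lambda>\<omega>. Z (u (Suc m)) \<omega> - Z (u m) \<omega>) -` A m \<inter> space M)) =
      prob {\<omega>\<in>space M. \<forall>j<m. Z (u (Suc j)) \<omega> - Z (u j) \<omega> \<in> A j} *
        prob ((\<lambda>\<omega>. Z (u (Suc m)) \<omega> - Z (u m) \<omega>) -` A m \<inter> space M)"
    by (rule increment_indep_past[OF u(1) u(2)[of m "Suc m"] _ A, simplified])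
qed

lemma crossing_prob_time_change:
  assumes W: "wiener_process M W" and t: "0 \<le> t"
  shows "crossing_prob M Z g t = crossing_prob M W g (q t)"
proof -
  define Y where "Y u = W (q u)" for u
  have W_meas: "W u \<in> borel_measurable M" if "0 \<le> u" for u
    using W that by (simp add: wiener_process_def)
  then have Y_meas: "Y u \<in> borel_measurable M" if "0 \<le> u" for u
    using that by (simp add: Y_def q_nonneg)
  have W_cont: "continuous_process M W" using W by (simp add: wiener_process_def)
  have qt: "continuous_on {0..t} q" using q_continuous by (rule continuous_on_subset) auto
  have Z_cont: "AE \<omega> in M. continuous_on {0..t} (\<lambda>u. Z u \<omega>)"
    using Z_continuous[unfolded continuous_process_def]
    by eventually_elim (auto elim: continuous_on_subset)
  have Y_cont: "AE \<omega> in M. continuous_on {0..t} (\<lambda>u. Y u \<omega>)"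
    using W_cont[unfolded continuous_process_def] unfolding Y_def
    by eventually_elim (rule continuous_on_compose2[OF _ qt], auto simp: q_nonneg)
  have "distr M borel (\<lambda>\<omega>. Max ((\<lambda>i. Z (grid 0 t n i) \<omega>) ` {..n})) =
      distr M borel (\<lambda>\<omega>. Max ((\<lambda>i. Y (grid 0 t n i) \<omega>) ` {..n}))" if n: "0 < n" for n
  proof (rule grid_max_distr_eq[OF n])
    let ?u = "grid 0 t n"
    have u: "0 \<le> ?u i" for i using t by (rule grid_ge)
    have u_mono: "?u i \<le> ?u j" if "i \<le> j" for i j using t that by (rule grid_mono)
    show Zm: "Z (?u i) \<in> borel_measurable M" and Ym: "Y (?u i) \<in> borel_measurable M" for i
      using u Z_measurable Y_meas by blast+
    show "AE \<omega> in M. Z (?u 0) \<omega> = 0" "AE \<omega> in M. Y (?u 0) \<omega> = 0"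
      using Z_starts_at_zero W by (auto simp: starts_at_zero_def wiener_process_def Y_def q_0)
    show "indep_vars (\<lambda>_. borel) (\<lambda>i \<omega>. Z (?u (Suc i)) \<omega> - Z (?u i) \<omega>) {..<n}"
      by (rule Z_increments_indep[OF u u_mono])
    have W_indep: "\<forall>(n::nat) v :: nat \<Rightarrow> real. 0 \<le> v 0 \<and> (\<forall>i<n. v i \<le> v (Suc i)) \<longrightarrow>
        indep_vars (\<lambda>_. borel) (\<lambda>i \<omega>. W (v (Suc i)) \<omega> - W (v i) \<omega>) {..<n}"
      using W by (simp add: wiener_process_def)
    \<comment> \<open>The times \<open>q (?u i)\<close> may repeat; independence in
      \<open>wiener_process\<close> is stated for weakly increasing times, so this is
      harmless.\<close>
    have "0 \<le> q (?u 0) \<and> (\<forall>i<n. q (?u i) \<le> q (?u (Suc i)))"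
      using u u_mono by (auto intro!: q_mono q_nonneg simp del: grid_0)
    then show "indep_vars (\<lambda>_. borel) (\<lambda>i \<omega>. Y (?u (Suc i)) \<omega> - Y (?u i) \<omega>) {..<n}"
      unfolding Y_def by (rule W_indep[rule_format, of "\<lambda>i. q (?u i)" n])
    show "distr M borel (\<lambda>\<omega>. Z (?u (Suc i)) \<omega> - Z (?u i) \<omega>) =
        distr M borel (\<lambda>\<omega>. Y (?u (Suc i)) \<omega> - Y (?u i) \<omega>)" for i
    proof (rule Levy_uniqueness)
      note [measurable] = Zm Ym
      have ui: "?u i \<le> ?u (Suc i)" by (rule u_mono) simp
      show "char (distr M borel (\<lambda>\<omega>. Z (?u (Suc i)) \<omega> - Z (?u i) \<omega>)) =
          char (distr M borel (\<lambda>\<omega>. Y (?u (Suc i)) \<omega> - Y (?u i) \<omega>))"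
        unfolding Y_def
        by (rule ext) (simp only: char_Z_increment[OF u ui] char_wiener_increment[OF W q_nonneg[OF u] q_mono[OF u ui]])
    qed (rule real_distribution_distr, use Zm Ym in measurable)+
  qed
  from crossing_event_prob_eq[OF t Z_measurable Y_meas Z_cont Y_cont this]
  obtain A B where AB: "A \<in> events" "B \<in> events" "prob A = prob B"
    "AE \<omega> in M. \<omega> \<in> A \<longleftrightarrow> (\<exists>u\<in>{0..t}. g \<le> Z u \<omega>)" "AE \<omega> in M. \<omega> \<in> B \<longleftrightarrow> (\<exists>u\<in>{0..t}. g \<le> Y u \<omega>)"
    by blast
  \<comment> \<open>As \<open>q\<close> is continuous and nondecreasing from 0, it skips no time up
    to \<open>q t\<close>; its intervals of constancy merely revisit one value of
    \<open>W\<close>.\<close>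
  have "q ` {0..t} = {0..q t}"
  proof (intro equalityI subsetI)
    fix v assume "v \<in> {0..q t}"
    then obtain u where "0 \<le> u" "u \<le> t" "q u = v"
      using IVT'[of q 0 v t] t qt q_0 by auto
    then show "v \<in> q ` {0..t}" by auto
  qed (auto intro: q_mono q_nonneg)
  then have "(\<exists>u\<in>{0..t}. g \<le> Y u \<omega>) \<longleftrightarrow> (\<exists>v\<in>{0..q t}. g \<le> W v \<omega>)" for \<omega>
    unfolding Y_def by (metis (no_types, lifting) image_iff)
  then have "crossing_prob M W g (q t) = prob B"
    using AB(5) by (intro crossing_prob_eq W_cont q_nonneg t AB(2)) auto
  moreover have "crossing_prob M Z g t = prob A"
    by (intro crossing_prob_eq Z_continuous t AB)
  ultimately show ?thesis using AB(3) by simp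
qed

end

theorem theorem2p3:
  fixes M :: "'a measure" and F :: "real \<Rightarrow> 'a measure"
    and Z V W :: "real \<Rightarrow> 'a \<Rightarrow> real" and q :: "real \<Rightarrow> real" and g :: real
  assumes "complete_stochastic_basis M F"
    and "0 < g"
    and "continuous_process M Z" and "local_martingale M F Z" and "starts_at_zero M Z"
    and "quadratic_variation M F Z V"
    and nonrandom: "\<And>t. 0 \<le> t \<Longrightarrow> AE \<omega> in M. V t \<omega> = q t"
    and "filterlim q at_top at_top"
    and "wiener_process M W" and "adapted F W"
  shows "\<forall>t\<ge>0. crossing_prob M Z g t = crossing_prob M W g (q t)"
proof -
  interpret nonrandom_qv M F Z V q
    using assms by (intro nonrandom_qv.intro nonrandom_qv_axioms.intro)
  show ?thesis using crossing_prob_time_change assms by blast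
qed

end
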